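(* Consider an $L$-layer network with full-precision gradients $\nabla_{\Theta^{(l)}}$, activation-compressed gradients $\hat\nabla_{\Theta^{(l)}}$, $\hat\nabla_{H^{(l)}}$, and randomly and unbiasedly quantized compressed contexts $\hat C^{(l)}$, as defined in the context. Then for every $l\in\{1,\dots,L\}$, $$\mathrm{Var}\big[\hat\nabla_{\Theta^{(l)}}\big]=\mathrm{Var}\big[\nabla_{\Theta^{(l)}}\big]+\sum_{m=l}^{L}\mathbb E\Big[\mathrm{Var}\Big[G_\Theta^{(l\sim m)}\big(\hat\nabla_{H^{(m)}},\hat C^{(m)}\big)\,\Big|\,\hat\nabla_{H^{(m)}}\Big]\Big].$$
   Context: **Variance of vectors.** For a random vector (or matrix, viewed as a vector) $x$, $\mathrm{Var}[x]:=\mathbb E\|x\|^2-\|\mathbb E[x]\|^2$. $\mathrm{Var}[x\mid y]$ denotes the corresponding conditional variance of $x$ given $y$. Expectations and variances are over all the randomness, i.e. the sampling of the minibatch and the random quantization. **Network.** A random minibatch $(X,Y)$ of size $N$ is sampled from a dataset $\mathcal D$. With $H^{(0)}=X$, layer $l\in\{1,\dots,L\}$ computes $H^{(l)}=F^{(l)}(H^{(l-1)};\Theta^{(l)})$, where $H^{(l)}$ is an $N\times D^{(l)}$ feature map and $\Theta^{(l)}$ is a vector of parameters. The minibatch loss is $\mathcal L=\ell(H^{(L)},Y)$. **Full-precision gradient.** $\nabla_{H^{(l)}}$ and $\nabla_{\Theta^{(l)}}$ denote the gradients of $\mathcal L$ with respect to $H^{(l)}$ and $\Theta^{(l)}$,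 computed by back-propagation $$(\nabla_{H^{(l-1)}},\nabla_{\Theta^{(l)}})=G^{(l)}\big(\nabla_{H^{(l)}},C^{(l)}\big),\qquad C^{(l)}=C(H^{(l-1)},\Theta^{(l)}),$$ where the context $C^{(l)}$ is the information kept in memory for back-propagation. By the chain rule, the context can be taken to be the collection of all partial derivatives $\partial H^{(l)}_{kp}/\partial H^{(l-1)}_{ij}$ and $\partial H^{(l)}_{kp}/\partial\Theta^{(l)}_i$, and then $G^{(l)}$ is $$\nabla_{H^{(l-1)}_{ij}}=\sum_{k,p}\frac{\partial H^{(l)}_{kp}}{\partial H^{(l-1)}_{ij}}\nabla_{H^{(l)}_{kp}},\qquad \nabla_{\Theta^{(l)}_{i}}=\sum_{k,p}\frac{\partial H^{(l)}_{kp}}{\partial \Theta^{(l)}_{i}}\nabla_{H^{(l)}_{kp}}.$$ Write $G_H^{(l)}$ and $G_\Theta^{(l)}$ for the components of $G^{(l)}$ giving the gradients with respect to $H^{(l-1)}$ and $\Theta^{(l)}$ respectively. Minibatch sampling is assumed unbiased: $\mathbb E[\nabla_{\Theta^{(l)}}]=\nabla_{\Theta^{(l)}}\mathcal L_{\mathcal D}(\Theta)$ for all $l$, where $\mathcal L_{\mathcal D}$ is the loss on the whole dataset. **Activation-compressed gradient.** With compressed contexts $\hat C^{(l)}=\hat C(H^{(l-1)},\Theta^{(l)})$, set $\hat\nabla_{H^{(L)}}=\nabla_{H^{(L)}}$ and, for $l=L,\dots,1$, $$(\hat\nabla_{H^{(l-1)}},\hat\nabla_{\Theta^{(l)}})=G^{(l)}\big(\hat\nabla_{H^{(l)}},\hat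 C^{(l)}\big).$$ **Quantization.** The contexts are quantized randomly by an unbiased quantizer: $\hat C^{(l)}=Q(C^{(l)})$, where $C^{(l)}$ is the collection of partial derivatives above and $\mathbb E[Q(x)]=x$ for all $x$. With such a quantization the activation-compressed gradient is an unbiased estimator, $\mathbb E[\hat\nabla_{\Theta}]=\nabla_\Theta\mathcal L_{\mathcal D}(\Theta)$. **Notation $G_\Theta^{(l\sim m)}$.** For $l\le m$, $$G_\Theta^{(l\sim m)}\big(\hat\nabla_{H^{(m)}},\hat C^{(m)}\big)=G_\Theta^{(l)}\Big(G_H^{(l+1)}\big(\cdots G_H^{(m)}(\hat\nabla_{H^{(m)}},\hat C^{(m)})\cdots,\,C^{(l+1)}\big),\,C^{(l)}\Big),$$ i.e. the gradient with respect to $\Theta^{(l)}$ computed from $\hat\nabla_{H^{(m)}}$ using the compressed context only at layer $m$ and the full-precision contexts at all the other layers; for $m=l$ it is $G_\Theta^{(l)}(\hat\nabla_{H^{(l)}},\hat C^{(l)})$.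
   Formalization: The inner variances are conditioned on the minibatch as well as on the compressed gradient of H^(m) (the literal identity fails for L=1, F=θh, ℓ=H, Q=id); differentiability, a finite dataset, finite quantizer variances and noise independent across layers and of the minibatch are explicit. *)

theory Defs
  imports "HOL-Probability.Probability"
begin

text \<open>
  The dimensions of the feature maps and parameters depend on the layer. A vector with finite
  index set \<open>I\<close> is therefore an element of \<open>I \<rightarrow>\<^sub>E UNIV\<close>, that is, a function that is
  \<open>undefined\<close> outside \<open>I\<close>; a matrix is indexed by pairs.
\<close>

definition partial :: "(('i \<Rightarrow> real) \<Rightarrow> real) \<Rightarrow> ('i \<Rightarrow> real) \<Rightarrow> 'i \<Rightarrow> real" where
  "partial f x i = deriv (\<lambda>t. f (x(i := t))) (x i)"

text \<open>Frechet differentiability of a real function on the Euclidean space \<open>I \<rightarrow>\<^sub>E UNIV\<close>.\<close>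

definition vec_differentiable :: "'i set \<Rightarrow> (('i \<Rightarrow> real) \<Rightarrow> real) \<Rightarrow> ('i \<Rightarrow> real) \<Rightarrow> bool" where
  "vec_differentiable I f x \<longleftrightarrow>
    (\<exists>g. \<forall>\<epsilon>>0. \<exists>\<delta>>0. \<forall>y \<in> I \<rightarrow>\<^sub>E UNIV. L2_set (\<lambda>i. y i - x i) I < \<delta> \<longrightarrow>
      \<bar>f y - f x - (\<Sum>i\<in>I. g i * (y i - x i))\<bar> \<le> \<epsilon> * L2_set (\<lambda>i. y i - x i) I)"

definition vec_var :: "'a measure \<Rightarrow> 'i set \<Rightarrow> ('a \<Rightarrow> 'i \<Rightarrow> real) \<Rightarrow> real" where
  "vec_var M I x =
    (\<integral>\<omega>. (L2_set (x \<omega>) I)\<^sup>2 \<partial>M) - (L2_set (\<lambda>i. \<integral>\<omega>. x \<omega> i \<partial>M) I)\<^sup>2"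

definition vec_cond_var ::
    "'a measure \<Rightarrow> 'a measure \<Rightarrow> 'i set \<Rightarrow> ('a \<Rightarrow> 'i \<Rightarrow> real) \<Rightarrow> 'a \<Rightarrow> real" where
  "vec_cond_var M F I x \<omega> =
    real_cond_exp M F (\<lambda>\<omega>'. (L2_set (x \<omega>') I)\<^sup>2) \<omega>
      - (L2_set (\<lambda>i. real_cond_exp M F (\<lambda>\<omega>'. x \<omega>' i) \<omega>) I)\<^sup>2"

type_synonym fmap = "nat \<times> nat \<Rightarrow> real"
type_synonym pvec = "nat \<Rightarrow> real"

text \<open>
  The context entry with index \<open>(kp, Inl ij)\<close> is the derivative of output entry \<open>kp\<close> of a layer
  with respect to its input entry \<open>ij\<close>, and the entry with index \<open>(kp, Inr i)\<close> is the derivative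
  with respect to the parameter \<open>i\<close> of the layer.
\<close>

type_synonym ctx_index = "(nat \<times> nat) \<times> ((nat \<times> nat) + nat)"
type_synonym ctx = "ctx_index \<Rightarrow> real"

text \<open>A minibatch assigns to each of its positions an example, i.e. a feature vector and a label.\<close>

type_synonym 'y minibatch = "nat \<Rightarrow> (nat \<Rightarrow> real) \<times> 'y"

text \<open>
  \<open>layer net l\<close> is used for \<open>l \<in> {1..depth net}\<close>; \<open>width net 0\<close> is the width of the input.
\<close>

record 'y network =
  batch_size :: nat
  depth :: nat
  width :: "nat \<Rightarrow> nat"
  num_params :: "nat \<Rightarrow> nat"
  layer :: "nat \<Rightarrow> fmap \<Rightarrow> pvec \<Rightarrow> fmap"
  loss :: "fmap \<Rightarrow> (nat \<Rightarrow> 'y) \<Rightarrow> real"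

definition fidx :: "'y network \<Rightarrow> nat \<Rightarrow> (nat \<times> nat) set" where
  "fidx net l = {..<batch_size net} \<times> {..<width net l}"

definition pidx :: "'y network \<Rightarrow> nat \<Rightarrow> nat set" where
  "pidx net l = {..<num_params net l}"

definition cidx :: "'y network \<Rightarrow> nat \<Rightarrow> ctx_index set" where
  "cidx net l = fidx net l \<times> (fidx net (l - 1) <+> pidx net l)"

definition minibatches :: "'y network \<Rightarrow> ((nat \<Rightarrow> real) \<times> 'y) set \<Rightarrow> 'y minibatch set" where
  "minibatches net D = {..<batch_size net} \<rightarrow>\<^sub>E D"

definition inputs :: "'y network \<Rightarrow> 'y minibatch \<Rightarrow> fmap" where
  "inputs net b = (\<lambda>(n, j) \<in> fidx net 0. fst (b n) j)"

definition labels :: "'y minibatch \<Rightarrow> nat \<Rightarrow> 'y" where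
  "labels b n = snd (b n)"

text \<open>\<open>run net \<theta> l n H\<close> is \<open>H\<^sup>(\<^sup>l\<^sup>+\<^sup>n\<^sup>)\<close> when the value of \<open>H\<^sup>(\<^sup>l\<^sup>)\<close> is \<open>H\<close>.\<close>

primrec run :: "'y network \<Rightarrow> (nat \<Rightarrow> pvec) \<Rightarrow> nat \<Rightarrow> nat \<Rightarrow> fmap \<Rightarrow> fmap" where
  "run net \<theta> l 0 H = H"
| "run net \<theta> l (Suc n) H =
    restrict (layer net (l + Suc n) (run net \<theta> l n H) (\<theta> (l + Suc n))) (fidx net (l + Suc n))"

definition feature :: "'y network \<Rightarrow> (nat \<Rightarrow> pvec) \<Rightarrow> 'y minibatch \<Rightarrow> nat \<Rightarrow> fmap" where
  "feature net \<theta> b l = run net \<theta> 0 l (inputs net b)"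

definition loss_from ::
    "'y network \<Rightarrow> (nat \<Rightarrow> pvec) \<Rightarrow> 'y minibatch \<Rightarrow> nat \<Rightarrow> fmap \<Rightarrow> real" where
  "loss_from net \<theta> b l H = loss net (run net \<theta> l (depth net - l) H) (labels b)"

definition minibatch_loss :: "'y network \<Rightarrow> (nat \<Rightarrow> pvec) \<Rightarrow> 'y minibatch \<Rightarrow> real" where
  "minibatch_loss net \<theta> b = loss net (feature net \<theta> b (depth net)) (labels b)"

definition grad_H :: "'y network \<Rightarrow> (nat \<Rightarrow> pvec) \<Rightarrow> 'y minibatch \<Rightarrow> nat \<Rightarrow> fmap" where
  "grad_H net \<theta> b l =
    restrict (partial (loss_from net \<theta> b l) (feature net \<theta> b l)) (fidx net l)"

definition grad_Theta :: "'y network \<Rightarrow> (nat \<Rightarrow> pvec) \<Rightarrow> 'y minibatch \<Rightarrow> nat \<Rightarrow> pvec" where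
  "grad_Theta net \<theta> b l =
    restrict (partial (\<lambda>u. minibatch_loss net (\<theta>(l := u)) b) (\<theta> l)) (pidx net l)"

definition ctx_of :: "'y network \<Rightarrow> (nat \<Rightarrow> pvec) \<Rightarrow> 'y minibatch \<Rightarrow> nat \<Rightarrow> ctx" where
  "ctx_of net \<theta> b l =
    (\<lambda>(kp, s) \<in> cidx net l.
      case s of
        Inl ij \<Rightarrow> partial (\<lambda>H. layer net l H (\<theta> l) kp) (feature net \<theta> b (l - 1)) ij
      | Inr i \<Rightarrow> partial (\<lambda>u. layer net l (feature net \<theta> b (l - 1)) u kp) (\<theta> l) i)"

definition G_H :: "'y network \<Rightarrow> nat \<Rightarrow> fmap \<Rightarrow> ctx \<Rightarrow> fmap" where
  "G_H net l v c = (\<lambda>ij \<in> fidx net (l - 1). \<Sum>kp\<in>fidx net l. c (kp, Inl ij) * v kp)"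

definition G_Theta :: "'y network \<Rightarrow> nat \<Rightarrow> fmap \<Rightarrow> ctx \<Rightarrow> pvec" where
  "G_Theta net l v c = (\<lambda>i \<in> pidx net l. \<Sum>kp\<in>fidx net l. c (kp, Inr i) * v kp)"

text \<open>
  \<open>back_H net c l n v\<close> propagates a gradient \<open>v\<close> from \<open>H\<^sup>(\<^sup>l\<^sup>+\<^sup>n\<^sup>)\<close> down to \<open>H\<^sup>(\<^sup>l\<^sup>)\<close>, using the
  contexts \<open>c\<close> of the layers \<open>l + n, ..., l + 1\<close>.
\<close>

primrec back_H :: "'y network \<Rightarrow> (nat \<Rightarrow> ctx) \<Rightarrow> nat \<Rightarrow> nat \<Rightarrow> fmap \<Rightarrow> fmap" where
  "back_H net c l 0 v = v"
| "back_H net c l (Suc n) v = G_H net (Suc l) (back_H net c (Suc l) n v) (c (Suc l))"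

definition hat_grad_H ::
    "'y network \<Rightarrow> (nat \<Rightarrow> pvec) \<Rightarrow> 'y minibatch \<Rightarrow> (nat \<Rightarrow> ctx) \<Rightarrow> nat \<Rightarrow> fmap" where
  "hat_grad_H net \<theta> b c l = back_H net c l (depth net - l) (grad_H net \<theta> b (depth net))"

definition hat_grad_Theta ::
    "'y network \<Rightarrow> (nat \<Rightarrow> pvec) \<Rightarrow> 'y minibatch \<Rightarrow> (nat \<Rightarrow> ctx) \<Rightarrow> nat \<Rightarrow> pvec" where
  "hat_grad_Theta net \<theta> b c l = G_Theta net l (hat_grad_H net \<theta> b c l) (c l)"

text \<open>
  \<open>G_Theta_between net C l m v c'\<close> is \<open>G\<^sub>\<Theta>\<^sup>(\<^sup>l\<^sup>\<sim>\<^sup>m\<^sup>)(v, c')\<close> for \<open>l \<le> m\<close>: the context of layer \<open>m\<close>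
  is \<open>c'\<close>, and the contexts of all other layers are taken from \<open>C\<close>.
\<close>

definition G_Theta_between ::
    "'y network \<Rightarrow> (nat \<Rightarrow> ctx) \<Rightarrow> nat \<Rightarrow> nat \<Rightarrow> fmap \<Rightarrow> ctx \<Rightarrow> pvec" where
  "G_Theta_between net C l m v c' =
    G_Theta net l (back_H net (C(m := c')) l (m - l) v) ((C(m := c')) l)"

text \<open>
  A random quantizer for vectors over \<open>I\<close> is a function \<open>q\<close> of the vector and of a noise value
  with distribution \<open>S\<close>. The variance of \<open>q\<close> is required to be finite.
\<close>

definition unbiased_quantizer ::
    "'z measure \<Rightarrow> 'i set \<Rightarrow> ('z \<Rightarrow> ('i \<Rightarrow> real) \<Rightarrow> 'i \<Rightarrow> real) \<Rightarrow> bool" where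
  "unbiased_quantizer S I q \<longleftrightarrow>
    (\<forall>x \<in> I \<rightarrow>\<^sub>E UNIV.
      (\<lambda>z. q z x) \<in> S \<rightarrow>\<^sub>M (\<Pi>\<^sub>M i\<in>I. borel) \<and>
      (\<forall>i\<in>I. integrable S (\<lambda>z. (q z x i)\<^sup>2) \<and> (\<integral>z. q z x i \<partial>S) = x i))"

definition hat_ctx ::
    "'y network \<Rightarrow> (nat \<Rightarrow> pvec) \<Rightarrow> (nat \<Rightarrow> 'z \<Rightarrow> ctx \<Rightarrow> ctx) \<Rightarrow> 'y minibatch \<Rightarrow> (nat \<Rightarrow> 'z) \<Rightarrow> nat \<Rightarrow> ctx"
  where
  "hat_ctx net \<theta> Q b z l = Q l (z l) (ctx_of net \<theta> b l)"

text \<open>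
  The sigma-algebra generated by the minibatch \<open>B\<close> and a random feature-map gradient \<open>V\<close> of layer
  \<open>m\<close>. The minibatch belongs to the conditioning data: the full-precision contexts are functions
  of it, so the sigma-algebra of \<open>V\<close> alone would put the sampling noise of these contexts, which is
  not due to quantization, into the conditional variance.
\<close>

definition batch_grad_algebra ::
    "'a measure \<Rightarrow> 'y network \<Rightarrow> ((nat \<Rightarrow> real) \<times> 'y) set \<Rightarrow> ('a \<Rightarrow> 'y minibatch) \<Rightarrow> nat \<Rightarrow>
      ('a \<Rightarrow> fmap) \<Rightarrow> 'a measure" where
  "batch_grad_algebra M net D B m V =
    vimage_algebra (space M) (\<lambda>\<omega>. (B \<omega>, V \<omega>))
      (count_space (minibatches net D) \<Otimes>\<^sub>M (\<Pi>\<^sub>M kp\<in>fidx net m. borel))"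

end

(* Let A m be the gradient with respect to the parameters of layer l that is computed from the
   compressed gradient at layer m with full-precision contexts at the layers l..m, and let X m be
   the same with the compressed context at layer m. Then X m = A (m - 1) for m > l, X l is the
   compressed gradient, and A L is the full-precision gradient by the chain rule. As X m is linear
   in the context of layer m, whose noise is independent of the minibatch and of the noise of the
   later layers, E[X m | batch, gradient at m] = A m. Hence the expected conditional variance of
   X m is E|X m|^2 - E|A m|^2, and the sum over m telescopes. *)

theory Submission
  imports Defs
begin

text \<open>Contexts are random through the minibatch, while the quantizer is known to be measurable
  in its noise for each fixed argument. The dataset is finite, so there are finitely many
  minibatches: measurability and expectations are treated with the minibatch frozen, which turns the
  exact contexts into constants, and are then averaged over its values by independence from the
  noise. The conditional expectation is identified by its defining property. For a frozen minibatch,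
  an event of the conditioning algebra is an event about the compressed gradient at layer
  \<open>m\<close>, hence about the noise of the layers above \<open>m\<close>; multiplying by its
  indicator preserves independence from the noise of layer \<open>m\<close>. The candidate
  \<open>A m\<close> is measurable for this algebra because the minibatch determines the exact
  contexts. Second moments stay finite along the backward pass because each product pairs a context
  entry with an independent gradient entry. Partial derivatives alone do not compose, so the chain
  rule is proved for total derivatives, whose coefficients are then recognized as the partial
  derivatives.\<close>

subsection \<open>Gradients and the chain rule\<close>

text \<open>The body of \<open>vec_differentiable\<close> with its witness \<open>g\<close> made
  explicit, so that the chain rule can track which gradient is obtained.\<close>

definition has_vec_gradient ::
    "'i set \<Rightarrow> (('i \<Rightarrow> real) \<Rightarrow> real) \<Rightarrow> ('i \<Rightarrow> real) \<Rightarrow> ('i \<Rightarrow> real) \<Rightarrow> bool" where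
  "has_vec_gradient I f x g \<longleftrightarrow>
    (\<forall>\<epsilon>>0. \<exists>\<delta>>0. \<forall>y \<in> I \<rightarrow>\<^sub>E UNIV. L2_set (\<lambda>i. y i - x i) I < \<delta> \<longrightarrow>
      \<bar>f y - f x - (\<Sum>i\<in>I. g i * (y i - x i))\<bar> \<le> \<epsilon> * L2_set (\<lambda>i. y i - x i) I)"

lemma has_vec_gradientD:
  assumes "has_vec_gradient I f x g" "\<epsilon> > 0"
  shows "\<exists>\<delta>>0. \<forall>y \<in> I \<rightarrow>\<^sub>E UNIV. L2_set (\<lambda>i. y i - x i) I < \<delta> \<longrightarrow>
      \<bar>f y - f x - (\<Sum>i\<in>I. g i * (y i - x i))\<bar> \<le> \<epsilon> * L2_set (\<lambda>i. y i - x i) I"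
  using assms unfolding has_vec_gradient_def by (elim allE impE)

lemma L2_set_single:
  assumes "finite I" "i \<in> I"
  shows "L2_set (\<lambda>j. (x(i := t)) j - x j) I = \<bar>t - x i\<bar>"
proof -
  have "(\<Sum>j\<in>I. ((x(i := t)) j - x j)\<^sup>2) = (\<Sum>j\<in>I. if j = i then (t - x i)\<^sup>2 else 0)"
    by (intro sum.cong) auto
  then show ?thesis
    using assms by (simp add: L2_set_def)
qed

text \<open>Along the line \<open>x(i := t)\<close> the linear part collapses to
  \<open>g i * (t - x i)\<close>, so the expansion is that of a one-variable derivative.
  Extensionality of \<open>x\<close> keeps this line inside the space. The gradient is thereby
  unique on \<open>I\<close>.\<close>

lemma has_vec_gradient_imp_partial:
  assumes "finite I" "x \<in> I \<rightarrow>\<^sub>E UNIV" "i \<in> I" "has_vec_gradient I f x g"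
  shows "partial f x i = g i"
proof -
  have "((\<lambda>t. f (x(i := t))) has_derivative (*) (g i)) (at (x i))"
    unfolding has_derivative_within_alt
  proof (intro conjI allI impI bounded_linear_mult_right)
    fix e :: real assume "e > 0"
    from has_vec_gradientD[OF assms(4) this] obtain \<delta> where "\<delta> > 0" and
      d: "\<forall>y \<in> I \<rightarrow>\<^sub>E UNIV. L2_set (\<lambda>i. y i - x i) I < \<delta> \<longrightarrow>
        \<bar>f y - f x - (\<Sum>i\<in>I. g i * (y i - x i))\<bar> \<le> e * L2_set (\<lambda>i. y i - x i) I"
      by (elim exE conjE)
    have "norm (f (x(i := t)) - f (x(i := x i)) - g i * (t - x i)) \<le> e * norm (t - x i)"
      if "norm (t - x i) < \<delta>" for t
    proof -
      have "(\<Sum>j\<in>I. g j * ((x(i := t)) j - x j)) = (\<Sum>j\<in>I. if j = i then g i * (t - x i) else 0)"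
        by (intro sum.cong) auto
      then have s: "(\<Sum>j\<in>I. g j * ((x(i := t)) j - x j)) = g i * (t - x i)"
        using assms(1,3) by simp
      have "x(i := t) \<in> I \<rightarrow>\<^sub>E UNIV"
        using assms(2,3) by (auto simp: PiE_def extensional_def)
      from d[THEN bspec, OF this] show ?thesis
        unfolding L2_set_single[OF assms(1,3)] s using that by simp
    qed
    then show "\<exists>d>0. \<forall>y\<in>UNIV. norm (y - x i) < d \<longrightarrow>
        norm (f (x(i := y)) - f (x(i := x i)) - g i * (y - x i)) \<le> e * norm (y - x i)"
      using \<open>\<delta> > 0\<close> by blast
  qed
  then show ?thesis
    unfolding partial_def by (intro DERIV_imp_deriv) (simp add: has_field_derivative_def)
qed

lemma has_vec_gradient_cong:
  assumes "\<And>i. i \<in> I \<Longrightarrow> g i = g' i"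
  shows "has_vec_gradient I f x g \<longleftrightarrow> has_vec_gradient I f x g'"
proof -
  have "(\<Sum>i\<in>I. g i * (y i - x i)) = (\<Sum>i\<in>I. g' i * (y i - x i))" for y
    using assms by (intro sum.cong) auto
  then show ?thesis
    unfolding has_vec_gradient_def by simp
qed

lemma vec_differentiable_imp_has_vec_gradient:
  assumes "vec_differentiable I f x" "finite I" "x \<in> I \<rightarrow>\<^sub>E UNIV"
  shows "has_vec_gradient I f x (partial f x)"
proof -
  obtain g where g: "has_vec_gradient I f x g"
    using assms(1) unfolding vec_differentiable_def has_vec_gradient_def by blast
  show ?thesis
    using g has_vec_gradient_cong[of I g "partial f x"]
      has_vec_gradient_imp_partial[OF assms(2,3) _ g] by metis
qed

text \<open>A crude substitute for Cauchy-Schwarz with the l1 norm of \<open>g\<close> as constant;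
  any constant independent of \<open>d\<close> serves the chain rule.\<close>

lemma abs_sum_mult_le_L2_set:
  assumes "finite I"
  shows "\<bar>\<Sum>i\<in>I. g i * d i\<bar> \<le> (\<Sum>i\<in>I. \<bar>g i\<bar>) * L2_set d I"
proof -
  have "\<bar>\<Sum>i\<in>I. g i * d i\<bar> \<le> (\<Sum>i\<in>I. \<bar>g i\<bar> * \<bar>d i\<bar>)"
    by (metis (no_types, lifting) abs_mult sum.cong sum_abs)
  also have "\<dots> \<le> (\<Sum>i\<in>I. \<bar>g i\<bar> * L2_set d I)"
  proof (intro sum_mono mult_left_mono)
    fix i assume "i \<in> I"
    then have "\<bar>d i\<bar> \<le> L2_set (\<lambda>i. \<bar>d i\<bar>) I"
      by (rule member_le_L2_set[OF assms])
    then show "\<bar>d i\<bar> \<le> L2_set d I"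
      by (simp add: L2_set_def)
  qed simp
  finally show ?thesis
    by (simp add: sum_distrib_right)
qed

text \<open>The intermediate value is cut to \<open>J\<close> because feature maps are extensional.
  The remainder of the composition is the outer remainder plus the outer gradient applied to the
  inner remainders, and each of the two gets half of \<epsilon>.\<close>

lemma has_vec_gradient_chain:
  assumes fin: "finite I" "finite J"
    and f: "\<And>j. j \<in> J \<Longrightarrow> has_vec_gradient I (\<lambda>y. f y j) x (a j)"
    and h: "has_vec_gradient J h (restrict (f x) J) b"
  shows "has_vec_gradient I (\<lambda>y. h (restrict (f y) J)) x (\<lambda>i. \<Sum>j\<in>J. a j i * b j)"
  unfolding has_vec_gradient_def
proof (intro allI impI)
  fix \<epsilon> :: real assume e: "\<epsilon> > 0"
  define N where "N y = L2_set (\<lambda>i. y i - x i) I" for y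
  define R where "R y j = f y j - f x j - (\<Sum>i\<in>I. a j i * (y i - x i))" for y j
  \<comment> \<open>\<open>K * N y\<close> will bound the increment of \<open>f\<close>. The inner
    \<open>+ 1\<close> pays for the remainder \<open>R y j\<close>, using \<eta> \<le> 1; the outer
    one keeps \<open>K\<close> positive even if \<open>J\<close> is empty.\<close>
  define K where "K = (\<Sum>j\<in>J. (\<Sum>i\<in>I. \<bar>a j i\<bar>) + 1) + 1"
  define b1 where "b1 = (\<Sum>j\<in>J. \<bar>b j\<bar>) + 1"
  \<comment> \<open>Tolerance for the inner remainders: weighted by \<open>b\<close> they add up to
    at most \<epsilon>/2 times the increment of the argument.\<close>
  define \<eta> where "\<eta> = min 1 (\<epsilon> / (2 * b1))"
  have K: "K > 0"
    unfolding K_def by (intro add_nonneg_pos sum_nonneg) auto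
  have b1: "b1 > 0"
    unfolding b1_def by (intro add_nonneg_pos sum_nonneg) auto
  have \<eta>: "\<eta> > 0" "\<eta> \<le> 1" "\<eta> * b1 \<le> \<epsilon> / 2"
    using e b1 by (auto simp: \<eta>_def min_def field_simps)
  have "\<epsilon> / (2 * K) > 0"
    using e K by simp
  from has_vec_gradientD[OF h this] obtain \<delta>0 where "\<delta>0 > 0" and
    d0: "\<forall>y \<in> J \<rightarrow>\<^sub>E UNIV. L2_set (\<lambda>j. y j - restrict (f x) J j) J < \<delta>0 \<longrightarrow>
      \<bar>h y - h (restrict (f x) J) - (\<Sum>j\<in>J. b j * (y j - restrict (f x) J j))\<bar>
        \<le> \<epsilon> / (2 * K) * L2_set (\<lambda>j. y j - restrict (f x) J j) J"
    by (elim exE conjE)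
  have "\<exists>\<delta>>0. \<forall>y\<in>I \<rightarrow>\<^sub>E UNIV. N y < \<delta> \<longrightarrow> \<bar>R y j\<bar> \<le> \<eta> * N y" if "j \<in> J" for j
    using has_vec_gradientD[OF f[OF that] \<eta>(1)] unfolding R_def N_def .
  then obtain \<delta>f where df: "\<And>j. j \<in> J \<Longrightarrow> \<delta>f j > 0"
    "\<And>j y. j \<in> J \<Longrightarrow> y \<in> I \<rightarrow>\<^sub>E UNIV \<Longrightarrow> N y < \<delta>f j \<Longrightarrow> \<bar>R y j\<bar> \<le> \<eta> * N y"
    by (metis (no_types, lifting))
  \<comment> \<open>The bound \<open>\<delta>0 / K\<close> forces the increment of \<open>f\<close>
    below \<open>\<delta>0\<close>; as an inserted element it also makes the set under
    \<open>Min\<close> nonempty.\<close>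
  define \<delta> where "\<delta> = Min (insert (\<delta>0 / K) (\<delta>f ` J))"
  have d: "\<delta> > 0" "\<delta> \<le> \<delta>0 / K" "\<And>j. j \<in> J \<Longrightarrow> \<delta> \<le> \<delta>f j"
    using fin \<open>\<delta>0 > 0\<close> df(1) K by (auto simp: \<delta>_def)
  have "\<bar>h (restrict (f y) J) - h (restrict (f x) J)
      - (\<Sum>i\<in>I. (\<Sum>j\<in>J. a j i * b j) * (y i - x i))\<bar> \<le> \<epsilon> * N y"
    if y: "y \<in> I \<rightarrow>\<^sub>E UNIV" and Ny: "N y < \<delta>" for y
  proof -
    have N0: "N y \<ge> 0"
      by (simp add: N_def L2_set_nonneg)
    have R: "\<bar>R y j\<bar> \<le> \<eta> * N y" if "j \<in> J" for j
      using df(2)[OF that y] d(3)[OF that] Ny by simp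
    define dn where "dn = L2_set (\<lambda>j. f y j - f x j) J"
    have "dn \<le> (\<Sum>j\<in>J. \<bar>f y j - f x j\<bar>)"
      unfolding dn_def by (rule L2_set_le_sum_abs)
    also have "\<dots> \<le> (\<Sum>j\<in>J. ((\<Sum>i\<in>I. \<bar>a j i\<bar>) + 1) * N y)"
    proof (intro sum_mono)
      fix j assume j: "j \<in> J"
      have "\<bar>f y j - f x j\<bar> \<le> \<bar>\<Sum>i\<in>I. a j i * (y i - x i)\<bar> + \<bar>R y j\<bar>"
        by (simp add: R_def)
      also have "\<dots> \<le> (\<Sum>i\<in>I. \<bar>a j i\<bar>) * N y + 1 * N y"
        using abs_sum_mult_le_L2_set[OF fin(1), of "a j" "\<lambda>i. y i - x i"] R[OF j]
          mult_right_mono[OF \<eta>(2) N0] unfolding N_def by linarith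
      finally show "\<bar>f y j - f x j\<bar> \<le> ((\<Sum>i\<in>I. \<bar>a j i\<bar>) + 1) * N y"
        by (simp add: algebra_simps)
    qed
    also have "\<dots> \<le> K * N y"
      using N0 unfolding K_def sum_distrib_right[symmetric] by (intro mult_right_mono) auto
    finally have dn: "dn \<le> K * N y" .
    also have "\<dots> < \<delta>0"
      using Ny d(2) K by (simp add: field_simps) (smt (verit) mult_strict_left_mono)
    finally have "dn < \<delta>0" .
    moreover have dn': "L2_set (\<lambda>j. restrict (f y) J j - restrict (f x) J j) J = dn"
      unfolding dn_def by (intro L2_set_cong) auto
    ultimately have "\<bar>h (restrict (f y) J) - h (restrict (f x) J)
        - (\<Sum>j\<in>J. b j * (restrict (f y) J j - restrict (f x) J j))\<bar> \<le> \<epsilon> / (2 * K) * dn"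
      using d0[THEN bspec, of "restrict (f y) J"] by simp
    moreover have "\<epsilon> / (2 * K) * dn \<le> \<epsilon> / 2 * N y"
      using mult_left_mono[OF dn, of "\<epsilon> / (2 * K)"] e K by simp
    moreover have "(\<Sum>j\<in>J. b j * (restrict (f y) J j - restrict (f x) J j))
        = (\<Sum>j\<in>J. b j * R y j) + (\<Sum>i\<in>I. (\<Sum>j\<in>J. a j i * b j) * (y i - x i))"
    proof -
      have "(\<Sum>i\<in>I. (\<Sum>j\<in>J. a j i * b j) * (y i - x i))
          = (\<Sum>j\<in>J. b j * (\<Sum>i\<in>I. a j i * (y i - x i)))"
        unfolding sum_distrib_left sum_distrib_right
        by (subst sum.swap) (simp add: algebra_simps)
      then show ?thesis
        by (simp add: R_def algebra_simps flip: sum.distrib)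
    qed
    moreover have "\<bar>\<Sum>j\<in>J. b j * R y j\<bar> \<le> \<epsilon> / 2 * N y"
    proof -
      have "\<bar>\<Sum>j\<in>J. b j * R y j\<bar> \<le> (\<Sum>j\<in>J. \<bar>b j\<bar> * \<bar>R y j\<bar>)"
        by (metis (no_types, lifting) abs_mult sum.cong sum_abs)
      also have "\<dots> \<le> (\<Sum>j\<in>J. \<bar>b j\<bar> * (\<eta> * N y))"
        by (intro sum_mono mult_left_mono R) auto
      also have "\<dots> \<le> b1 * (\<eta> * N y)"
        using \<eta>(1) N0 unfolding b1_def sum_distrib_right[symmetric] by (intro mult_right_mono) auto
      also have "\<dots> \<le> \<epsilon> / 2 * N y"
        using mult_right_mono[OF \<eta>(3) N0] by (simp add: algebra_simps)
      finally show ?thesis .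
    qed
    ultimately show ?thesis
      by linarith
  qed
  then show "\<exists>\<delta>>0. \<forall>y\<in>I \<rightarrow>\<^sub>E UNIV. L2_set (\<lambda>i. y i - x i) I < \<delta> \<longrightarrow>
      \<bar>h (restrict (f y) J) - h (restrict (f x) J) - (\<Sum>i\<in>I. (\<Sum>j\<in>J. a j i * b j) * (y i - x i))\<bar>
        \<le> \<epsilon> * L2_set (\<lambda>i. y i - x i) I"
    using d(1) unfolding N_def by blast
qed

subsection \<open>Exact back-propagation\<close>

lemma finite_idx [simp]: "finite (fidx net l)" "finite (pidx net l)"
  by (simp_all add: fidx_def pidx_def)

lemma Inl_Inr_in_Plus [simp]: "Inl x \<in> A <+> B \<longleftrightarrow> x \<in> A" "Inr y \<in> A <+> B \<longleftrightarrow> y \<in> B"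
  by auto

lemma finite_cidx [simp]: "finite (cidx net l)"
  by (simp add: cidx_def)

lemma cidx_SucI [simp]: "kp \<in> fidx net (Suc m) \<Longrightarrow> ij \<in> fidx net m \<Longrightarrow> (kp, Inl ij) \<in> cidx net (Suc m)"
  by (simp add: cidx_def)

lemma fst_cidx [simp]: "k \<in> cidx net m \<Longrightarrow> fst k \<in> fidx net m"
  by (auto simp: cidx_def)

lemma run_add: "run net \<theta> l (n + k) H = run net \<theta> (l + n) k (run net \<theta> l n H)"
  by (induction k) (simp_all add: add.assoc)

lemma run_cong:
  assumes "\<And>j. l < j \<Longrightarrow> j \<le> l + n \<Longrightarrow> \<theta> j = \<theta>' j"
  shows "run net \<theta> l n H = run net \<theta>' l n H"
  using assms by (induction n) simp_all

lemma feature_Suc: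
  "feature net \<theta> b (Suc l) =
    restrict (layer net (Suc l) (feature net \<theta> b l) (\<theta> (Suc l))) (fidx net (Suc l))"
  by (simp add: feature_def)

lemma feature_PiE: "feature net \<theta> b l \<in> fidx net l \<rightarrow>\<^sub>E UNIV"
  by (cases l) (auto simp: feature_def inputs_def)

text \<open>\<open>run\<close> recurses on its last layer, but back-propagation differentiates
  through the lowest remaining one, so \<open>run_add\<close> is used to split off a single layer at
  the bottom.\<close>

lemma loss_from_less:
  assumes "l < depth net"
  shows "loss_from net \<theta> b l H =
    loss_from net \<theta> b (Suc l) (restrict (layer net (Suc l) H (\<theta> (Suc l))) (fidx net (Suc l)))"
proof -
  have "depth net - l = Suc 0 + (depth net - Suc l)"
    using assms by simp
  then show ?thesis
    unfolding loss_from_def by (simp only: run_add) simp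
qed

text \<open>The updated parameter is read by layer \<open>l\<close> alone: the layers below and
  above run with the old \<open>\<theta>\<close>. The loss is therefore a composition through one
  layer, ready for the chain rule.\<close>

lemma minibatch_loss_update:
  assumes "l \<in> {1..depth net}"
  shows "minibatch_loss net (\<theta>(l := u)) b =
    loss_from net \<theta> b l (restrict (layer net l (feature net \<theta> b (l - 1)) u) (fidx net l))"
proof -
  obtain k where k: "l = Suc k"
    using assms by (cases l) auto
  have "minibatch_loss net (\<theta>(l := u)) b =
      loss net (run net (\<theta>(l := u)) l (depth net - l) (run net (\<theta>(l := u)) 0 l (inputs net b)))
        (labels b)"
    using run_add[of net "\<theta>(l := u)" 0 l "depth net - l"] assms
    by (simp add: minibatch_loss_def feature_def)
  also have "run net (\<theta>(l := u)) 0 l (inputs net b) =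
      restrict (layer net l (feature net \<theta> b (l - 1)) u) (fidx net l)"
    using run_cong[of 0 k "\<theta>(l := u)" \<theta> net] by (simp add: k feature_def)
  also have "run net (\<theta>(l := u)) l (depth net - l) = run net \<theta> l (depth net - l)"
    by (intro ext run_cong) simp
  finally show ?thesis
    unfolding loss_from_def .
qed

lemma ctx_of_Inl:
  assumes "kp \<in> fidx net l" "ij \<in> fidx net (l - 1)"
  shows "ctx_of net \<theta> b l (kp, Inl ij) =
    partial (\<lambda>H. layer net l H (\<theta> l) kp) (feature net \<theta> b (l - 1)) ij"
  using assms by (simp add: ctx_of_def cidx_def)

lemma ctx_of_Inr:
  assumes "kp \<in> fidx net l" "i \<in> pidx net l"
  shows "ctx_of net \<theta> b l (kp, Inr i) =
    partial (\<lambda>u. layer net l (feature net \<theta> b (l - 1)) u kp) (\<theta> l) i"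
  using assms by (simp add: ctx_of_def cidx_def)

lemma hat_grad_H_less:
  assumes "l < depth net"
  shows "hat_grad_H net \<theta> b c l = G_H net (Suc l) (hat_grad_H net \<theta> b c (Suc l)) (c (Suc l))"
  using assms Suc_diff_Suc[OF assms] unfolding hat_grad_H_def
  by (metis back_H.simps(2))

lemma hat_grad_H_depth: "hat_grad_H net \<theta> b c (depth net) = grad_H net \<theta> b (depth net)"
  by (simp add: hat_grad_H_def)

lemma hat_grad_H_PiE: "l \<le> depth net \<Longrightarrow> hat_grad_H net \<theta> b c l \<in> fidx net l \<rightarrow>\<^sub>E UNIV"
  using hat_grad_H_less[of l net \<theta> b c]
  by (cases "l = depth net") (auto simp: hat_grad_H_depth grad_H_def G_H_def)

lemma hat_grad_H_cong:
  assumes "l \<le> depth net" "\<And>j. l < j \<Longrightarrow> j \<le> depth net \<Longrightarrow> c j = c' j"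
  shows "hat_grad_H net \<theta> b c l = hat_grad_H net \<theta> b c' l"
  using assms
  by (induction rule: inc_induct) (simp_all add: hat_grad_H_depth hat_grad_H_less)

section \<open>Exact contexts reproduce the gradient of the loss of a fixed minibatch\<close>

context
  fixes net :: "'y network" and \<theta> :: "nat \<Rightarrow> pvec" and b :: "'y minibatch"
  assumes \<theta>: "\<And>l. l \<in> {1..depth net} \<Longrightarrow> \<theta> l \<in> pidx net l \<rightarrow>\<^sub>E UNIV"
    and diff_H: "\<And>l kp. l \<in> {1..depth net} \<Longrightarrow> kp \<in> fidx net l \<Longrightarrow>
      vec_differentiable (fidx net (l - 1)) (\<lambda>H. layer net l H (\<theta> l) kp)
        (feature net \<theta> b (l - 1))"
    and diff_Theta: "\<And>l kp. l \<in> {1..depth net} \<Longrightarrow> kp \<in> fidx net l \<Longrightarrow>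
      vec_differentiable (pidx net l) (\<lambda>u. layer net l (feature net \<theta> b (l - 1)) u kp) (\<theta> l)"
    and diff_loss: "vec_differentiable (fidx net (depth net)) (\<lambda>H. loss net H (labels b))
      (feature net \<theta> b (depth net))"
begin

text \<open>Downward induction from the output layer: the sum produced by the chain rule through
  layer \<open>Suc l\<close> is the formula of \<open>G_H\<close> with exact contexts. A total
  derivative, not merely partial ones, has to be carried so that the chain rule applies again at the
  next layer.\<close>

lemma loss_from_has_gradient:
  assumes "l \<le> depth net"
  shows "has_vec_gradient (fidx net l) (loss_from net \<theta> b l) (feature net \<theta> b l)
    (hat_grad_H net \<theta> b (ctx_of net \<theta> b) l)"
  using assms
proof (induction rule: inc_induct)
  case base
  have "loss_from net \<theta> b (depth net) = (\<lambda>H. loss net H (labels b))"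
    by (simp add: loss_from_def fun_eq_iff)
  then have "has_vec_gradient (fidx net (depth net)) (loss_from net \<theta> b (depth net))
      (feature net \<theta> b (depth net)) (partial (loss_from net \<theta> b (depth net)) (feature net \<theta> b (depth net)))"
    using vec_differentiable_imp_has_vec_gradient[OF diff_loss _ feature_PiE] by simp
  from iffD1[OF has_vec_gradient_cong this] show ?case
    by (simp add: hat_grad_H_depth grad_H_def)
next
  case (step l)
  let ?f = "\<lambda>H. layer net (Suc l) H (\<theta> (Suc l))"
  have f: "has_vec_gradient (fidx net l) (\<lambda>H. ?f H j) (feature net \<theta> b l)
      (partial (\<lambda>H. ?f H j) (feature net \<theta> b l))" if "j \<in> fidx net (Suc l)" for j
    using vec_differentiable_imp_has_vec_gradient[OF diff_H[of "Suc l" j]] that step(2)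
      feature_PiE[of net \<theta> b l] by simp
  have "has_vec_gradient (fidx net l) (loss_from net \<theta> b l) (feature net \<theta> b l)
    (\<lambda>i. \<Sum>j\<in>fidx net (Suc l). partial (\<lambda>H. ?f H j) (feature net \<theta> b l) i
      * hat_grad_H net \<theta> b (ctx_of net \<theta> b) (Suc l) j)"
    unfolding loss_from_less[OF step(2), abs_def]
    by (rule has_vec_gradient_chain[where a = "\<lambda>j. partial (\<lambda>H. ?f H j) (feature net \<theta> b l)"])
      (use f step(3)[unfolded feature_Suc] in \<open>(simp only: finite_idx | blast)+\<close>)
  then show ?case
  proof (rule iffD1[OF has_vec_gradient_cong, rotated])
    fix i assume "i \<in> fidx net l"
    then show "(\<Sum>j\<in>fidx net (Suc l). partial (\<lambda>H. ?f H j) (feature net \<theta> b l) i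
        * hat_grad_H net \<theta> b (ctx_of net \<theta> b) (Suc l) j) =
      hat_grad_H net \<theta> b (ctx_of net \<theta> b) l i"
      by (simp add: hat_grad_H_less[OF step(2)] G_H_def ctx_of_Inl)
  qed
qed

text \<open>One more use of the chain rule, now in the direction of the parameters of layer
  \<open>l\<close>, composed with the gradient already known at its output.\<close>

lemma hat_grad_Theta_ctx_of:
  assumes "l \<in> {1..depth net}"
  shows "hat_grad_Theta net \<theta> b (ctx_of net \<theta> b) l = grad_Theta net \<theta> b l"
proof
  fix i
  show "hat_grad_Theta net \<theta> b (ctx_of net \<theta> b) l i = grad_Theta net \<theta> b l i"
  proof (cases "i \<in> pidx net l")
    case True
    obtain k where k: "l = Suc k"
      using assms by (cases l) auto
    let ?f = "layer net l (feature net \<theta> b (l - 1))"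
    have f: "has_vec_gradient (pidx net l) (\<lambda>u. ?f u j) (\<theta> l) (partial (\<lambda>u. ?f u j) (\<theta> l))"
      if "j \<in> fidx net l" for j
      using vec_differentiable_imp_has_vec_gradient[OF diff_Theta[of l j]] \<theta> that assms by simp
    have "has_vec_gradient (pidx net l) (\<lambda>u. minibatch_loss net (\<theta>(l := u)) b) (\<theta> l)
      (\<lambda>i. \<Sum>j\<in>fidx net l. partial (\<lambda>u. ?f u j) (\<theta> l) i
        * hat_grad_H net \<theta> b (ctx_of net \<theta> b) l j)"
      unfolding minibatch_loss_update[OF assms]
      using f loss_from_has_gradient[of l] assms feature_Suc[of net \<theta> b k] k
      by (intro has_vec_gradient_chain[where a = "\<lambda>j. partial (\<lambda>u. ?f u j) (\<theta> l)"]) simp_all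
    from has_vec_gradient_imp_partial[OF _ \<theta>[OF assms] True this]
    show ?thesis
      using True by (simp add: hat_grad_Theta_def G_Theta_def grad_Theta_def ctx_of_Inr)
  qed (simp add: hat_grad_Theta_def G_Theta_def grad_Theta_def)
qed

end

text \<open>\<open>J\<close> is the product of the Jacobians stored in \<open>c\<close>. Its
  existence before the choice of \<open>v\<close> is all that is used later, so no closed form is
  recorded.\<close>

lemma back_H_linear:
  "\<exists>J. \<forall>v. \<forall>ij\<in>fidx net l. back_H net c l n v ij = (\<Sum>kp\<in>fidx net (l + n). J ij kp * v kp)"
proof (induction n arbitrary: l)
  case 0
  have "v ij = (\<Sum>kp\<in>fidx net l. of_bool (kp = ij) * v kp)" if "ij \<in> fidx net l" for v :: fmap and ij
    using that by (simp add: of_bool_def if_distrib if_distribR cong: if_cong)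
  then show ?case
    by (intro exI[of _ "\<lambda>ij kp. of_bool (kp = ij)"]) simp
next
  case (Suc n)
  obtain J where J: "\<And>v ij. ij \<in> fidx net (Suc l) \<Longrightarrow>
      back_H net c (Suc l) n v ij = (\<Sum>kp\<in>fidx net (l + Suc n). J ij kp * v kp)"
    using Suc[of "Suc l"] by auto
  show ?case
  proof (intro exI allI ballI)
    fix v ij assume ij: "ij \<in> fidx net l"
    have "back_H net c l (Suc n) v ij
        = (\<Sum>r\<in>fidx net (Suc l). c (Suc l) (r, Inl ij) * (\<Sum>kp\<in>fidx net (l + Suc n). J r kp * v kp))"
      using ij by (simp add: G_H_def J)
    also have "\<dots> = (\<Sum>kp\<in>fidx net (l + Suc n).
        (\<Sum>r\<in>fidx net (Suc l). c (Suc l) (r, Inl ij) * J r kp) * v kp)"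
      unfolding sum_distrib_left sum_distrib_right by (subst sum.swap) (simp add: algebra_simps)
    finally show "back_H net c l (Suc n) v ij = (\<Sum>kp\<in>fidx net (l + Suc n).
        (\<Sum>r\<in>fidx net (Suc l). c (Suc l) (r, Inl ij) * J r kp) * v kp)" .
  qed
qed

lemma back_H_cong:
  "(\<And>j. l < j \<Longrightarrow> j \<le> l + n \<Longrightarrow> c j = c' j) \<Longrightarrow> back_H net c l n v = back_H net c' l n v"
  by (induction n arbitrary: l) simp_all

text \<open>The definition exposes the lowest layer last; this form exposes the topmost one, where
  the replaced context of \<open>G_Theta_between\<close> sits.\<close>

lemma back_H_Suc_top:
  "back_H net c l (Suc n) v = back_H net c l n (G_H net (l + Suc n) v (c (l + Suc n)))"
  by (induction n arbitrary: l) simp_all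

text \<open>The replaced context is consumed by the topmost backward step, and everything below
  reads only \<open>C\<close>. This is the identity that links consecutive terms of the telescoping
  sum.\<close>

lemma G_Theta_between_less:
  assumes "l < m"
  shows "G_Theta_between net C l m v c' = G_Theta_between net C l (m - 1) (G_H net m v c') (C (m - 1))"
proof -
  obtain n where n: "m = l + Suc n"
    using assms less_iff_Suc_add by auto
  have "back_H net (C(m := c')) l (Suc n) v = back_H net C l n (G_H net m v c')"
    unfolding back_H_Suc_top using back_H_cong[of l n "C(m := c')" C] by (simp add: n)
  then show ?thesis
    by (simp add: G_Theta_between_def n)
qed

lemma G_Theta_between_same: "G_Theta_between net C l l v c' = G_Theta net l v c'"
  by (simp add: G_Theta_between_def)

text \<open>Exhibits bilinearity in the incoming gradient and the context of layer \<open>m\<close>,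
  with weights depending only on the contexts of the layers below \<open>m\<close>. The index
  \<open>s\<close> covers both kinds of context entries: for \<open>l = m\<close> only
  \<open>Inr i\<close> has nonzero weight, for \<open>l < m\<close> only the \<open>Inl\<close>
  entries contribute.\<close>

lemma G_Theta_between_linear:
  assumes "l \<le> m" "i \<in> pidx net l"
  shows "\<exists>a. \<forall>v c'. G_Theta_between net C l m v c' i =
    (\<Sum>s\<in>fidx net (m - 1) <+> pidx net m. a s * (\<Sum>kp\<in>fidx net m. c' (kp, s) * v kp))"
proof (cases "l = m")
  case True
  have "G_Theta_between net C l m v c' i = (\<Sum>s\<in>fidx net (m - 1) <+> pidx net m.
      of_bool (s = Inr i) * (\<Sum>kp\<in>fidx net m. c' (kp, s) * v kp))" for v c'
    using assms(2) True
    by (simp add: sum.Plus G_Theta_between_same G_Theta_def of_bool_def if_distrib if_distribR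
        cong: if_cong)
  then show ?thesis
    by (intro exI[of _ "\<lambda>s. of_bool (s = Inr i)"]) blast
next
  case False
  then obtain n where n: "m = l + Suc n"
    using assms(1) less_iff_Suc_add[of l m] by auto
  obtain J where J: "\<And>v ij. ij \<in> fidx net l \<Longrightarrow>
      back_H net C l n v ij = (\<Sum>kp\<in>fidx net (l + n). J ij kp * v kp)"
    using back_H_linear[of net l C n] by blast
  define a where "a ij = (\<Sum>r\<in>fidx net l. C l (r, Inr i) * J r ij)" for ij
  have "G_Theta_between net C l m v c' i = (\<Sum>s\<in>fidx net (m - 1) <+> pidx net m.
      (case s of Inl ij \<Rightarrow> a ij | Inr _ \<Rightarrow> 0) * (\<Sum>kp\<in>fidx net m. c' (kp, s) * v kp))" for v c'
  proof -
    have "G_Theta_between net C l m v c' i =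
        (\<Sum>r\<in>fidx net l. C l (r, Inr i) * (\<Sum>ij\<in>fidx net (m - 1). J r ij * G_H net m v c' ij))"
      using assms(2) J by (subst G_Theta_between_less) (simp_all add: n G_Theta_between_def G_Theta_def)
    also have "\<dots> = (\<Sum>ij\<in>fidx net (m - 1). a ij * G_H net m v c' ij)"
      unfolding a_def sum_distrib_left sum_distrib_right
      by (subst sum.swap) (simp add: algebra_simps)
    finally show ?thesis
      by (simp add: sum.Plus G_H_def)
  qed
  then show ?thesis
    by blast
qed

text \<open>If one family of contexts is used everywhere, it does not matter at which layer the
  backward pass is cut.\<close>

lemma G_Theta_between_grad:
  assumes "l \<le> m" "m \<le> depth net"
  shows "G_Theta_between net c l m (hat_grad_H net \<theta> b c m) (c m) = hat_grad_Theta net \<theta> b c l"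
  using assms
proof (induction m rule: dec_induct)
  case base
  then show ?case
    by (simp add: G_Theta_between_same hat_grad_Theta_def)
next
  case (step m)
  have "G_Theta_between net c l (Suc m) (hat_grad_H net \<theta> b c (Suc m)) (c (Suc m)) =
      G_Theta_between net c l m (hat_grad_H net \<theta> b c m) (c m)"
    using step.hyps step.prems by (simp add: G_Theta_between_less hat_grad_H_less)
  also have "\<dots> = hat_grad_Theta net \<theta> b c l"
    by (rule step.IH) (use step.prems in simp)
  finally show ?case .
qed

subsection \<open>Quantization noise\<close>

lemma L2_set_power2: "(L2_set f I)\<^sup>2 = (\<Sum>i\<in>I. (f i)\<^sup>2)"
  by (simp add: L2_set_def sum_nonneg)

text \<open>Induction with (x + y)^2 \<le> 2 x^2 + 2 y^2, so no information on the joint law of the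
  summands is required.\<close>

lemma square_integrable_sum:
  fixes f :: "'i \<Rightarrow> 'a \<Rightarrow> real"
  assumes "finite I" "\<And>i. i \<in> I \<Longrightarrow> f i \<in> borel_measurable M"
    and "\<And>i. i \<in> I \<Longrightarrow> integrable M (\<lambda>\<omega>. (f i \<omega>)\<^sup>2)"
  shows "integrable M (\<lambda>\<omega>. (\<Sum>i\<in>I. f i \<omega>)\<^sup>2)"
  using assms
proof (induction I rule: finite_induct)
  case (insert j I)
  have [measurable]: "f j \<in> borel_measurable M" "(\<lambda>\<omega>. \<Sum>i\<in>I. f i \<omega>) \<in> borel_measurable M"
    using insert.prems(1) by auto
  have int: "integrable M (\<lambda>\<omega>. 2 * (f j \<omega>)\<^sup>2 + 2 * (\<Sum>i\<in>I. f i \<omega>)\<^sup>2)"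
    using insert by auto
  have "(x + y)\<^sup>2 \<le> 2 * x\<^sup>2 + 2 * y\<^sup>2" for x y :: real
    using zero_le_power2[of "x - y"] by (simp add: power2_eq_square algebra_simps)
  then show ?case
    using insert.hyps by (intro Bochner_Integration.integrable_bound[OF int]) auto
qed simp

lemma finite_minibatches: "finite D \<Longrightarrow> finite (minibatches net D)"
  by (simp add: minibatches_def finite_PiE)

lemma ctx_of_PiE: "ctx_of net \<theta> b l \<in> cidx net l \<rightarrow>\<^sub>E UNIV"
  by (simp add: ctx_of_def)

text \<open>The sigma-algebra generated by a variable measurable for \<open>F\<close> lies inside
  \<open>F\<close>, and likewise for \<open>G\<close>, so independence of the algebras passes to the
  variables.\<close>

lemma (in prob_space) indep_var_of_indep_set:
  assumes ind: "indep_set (sets F) (sets G)"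
    and f: "f \<in> F \<rightarrow>\<^sub>M N1" and g: "g \<in> G \<rightarrow>\<^sub>M N2"
    and sp: "space F = space M" "space G = space M"
  shows "indep_var N1 f N2 g"
proof -
  have sub: "subalgebra M F" "subalgebra M G"
    using ind sp by (auto simp: subalgebra_def indep_sets2_eq)
  have "sigma_sets (space M) {f -` A \<inter> space M |A. A \<in> sets N1} \<subseteq> sets F"
    using measurable_sets[OF f] unfolding sp(1)[symmetric] by (intro sets.sigma_sets_subset) auto
  moreover have "sigma_sets (space M) {g -` A \<inter> space M |A. A \<in> sets N2} \<subseteq> sets G"
    using measurable_sets[OF g] unfolding sp(2)[symmetric] by (intro sets.sigma_sets_subset) auto
  ultimately show ?thesis
    using ind measurable_from_subalg[OF sub(1) f] measurable_from_subalg[OF sub(2) g]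
    unfolding indep_var_eq indep_sets2_eq by (intro conjI) (blast | force)+
qed

section \<open>The minibatch and the quantization noise as independent random elements\<close>

locale compressed_backprop = prob_space M
  for M :: "'a measure" +
  fixes net :: "'y network"
    and \<theta> :: "nat \<Rightarrow> pvec"
    and D :: "((nat \<Rightarrow> real) \<times> 'y) set"
    and B :: "'a \<Rightarrow> 'y minibatch"
    and S :: "nat \<Rightarrow> 'z measure"
    and \<xi> :: "nat \<Rightarrow> 'a \<Rightarrow> 'z"
    and Q :: "nat \<Rightarrow> 'z \<Rightarrow> ctx \<Rightarrow> ctx"
  assumes finite_D: "finite D"
    and noise_indep: "indep_vars S \<xi> {1..depth net}"
    and measurable_B: "B \<in> M \<rightarrow>\<^sub>M count_space (minibatches net D)"
    and batch_indep: "indep_set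
      (sets (vimage_algebra (space M) B (count_space (minibatches net D))))
      (sets (vimage_algebra (space M) (\<lambda>\<omega>. \<lambda>l\<in>{1..depth net}. \<xi> l \<omega>)
        (\<Pi>\<^sub>M l\<in>{1..depth net}. S l)))"
    and quantizer: "\<And>l. l \<in> {1..depth net} \<Longrightarrow>
      unbiased_quantizer (distr M (S l) (\<xi> l)) (cidx net l) (Q l)"
begin

text \<open>All noise values as one random element of the product space; the restriction makes it
  extensional, as the product measure demands.\<close>

definition noise :: "'a \<Rightarrow> nat \<Rightarrow> 'z" where
  "noise \<omega> = (\<lambda>l\<in>{1..depth net}. \<xi> l \<omega>)"

text \<open>A deterministic function of minibatch and noise values, so that \<open>b\<close> can be
  frozen while the noise stays random.\<close>

definition hat_H :: "nat \<Rightarrow> 'y minibatch \<Rightarrow> (nat \<Rightarrow> 'z) \<Rightarrow> fmap" where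
  "hat_H m b z = hat_grad_H net \<theta> b (hat_ctx net \<theta> Q b z) m"

text \<open>\<open>mixed_grad l m\<close> and \<open>mean_grad l m\<close> are the \<open>X m\<close> and \<open>A m\<close> of the proof idea above.\<close>

definition mixed_grad :: "nat \<Rightarrow> nat \<Rightarrow> 'y minibatch \<Rightarrow> (nat \<Rightarrow> 'z) \<Rightarrow> pvec" where
  "mixed_grad l m b z =
    G_Theta_between net (ctx_of net \<theta> b) l m (hat_H m b z) (hat_ctx net \<theta> Q b z m)"

definition mean_grad :: "nat \<Rightarrow> nat \<Rightarrow> 'y minibatch \<Rightarrow> (nat \<Rightarrow> 'z) \<Rightarrow> pvec" where
  "mean_grad l m b z =
    G_Theta_between net (ctx_of net \<theta> b) l m (hat_H m b z) (ctx_of net \<theta> b m)"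

definition cond_algebra :: "nat \<Rightarrow> 'a measure" where
  "cond_algebra m = batch_grad_algebra M net D B m (\<lambda>\<omega>. hat_H m (B \<omega>) (noise \<omega>))"

lemma measurable_xi: "l \<in> {1..depth net} \<Longrightarrow> \<xi> l \<in> M \<rightarrow>\<^sub>M S l"
  using noise_indep by (simp add: indep_vars_def)

lemma measurable_noise: "noise \<in> M \<rightarrow>\<^sub>M (\<Pi>\<^sub>M l\<in>{1..depth net}. S l)"
  unfolding noise_def[abs_def] using measurable_xi by (intro measurable_restrict) auto

lemma indep_batch_noise:
  assumes "f \<in> count_space (minibatches net D) \<rightarrow>\<^sub>M N1" "g \<in> (\<Pi>\<^sub>M l\<in>{1..depth net}. S l) \<rightarrow>\<^sub>M N2"
  shows "indep_var N1 (\<lambda>\<omega>. f (B \<omega>)) N2 (\<lambda>\<omega>. g (noise \<omega>))"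
proof (rule indep_var_of_indep_set)
  show "indep_set (sets (vimage_algebra (space M) B (count_space (minibatches net D))))
      (sets (vimage_algebra (space M) noise (\<Pi>\<^sub>M l\<in>{1..depth net}. S l)))"
    using batch_indep unfolding noise_def[abs_def] .
  show "(\<lambda>\<omega>. f (B \<omega>)) \<in> vimage_algebra (space M) B (count_space (minibatches net D)) \<rightarrow>\<^sub>M N1"
    using measurable_space[OF measurable_B]
    by (intro measurable_compose[OF measurable_vimage_algebra1 assms(1)]) auto
  show "(\<lambda>\<omega>. g (noise \<omega>)) \<in> vimage_algebra (space M) noise (\<Pi>\<^sub>M l\<in>{1..depth net}. S l) \<rightarrow>\<^sub>M N2"
    using measurable_space[OF measurable_noise]
    by (intro measurable_compose[OF measurable_vimage_algebra1 assms(2)]) auto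
qed simp_all

text \<open>Measurability in the noise for each frozen minibatch suffices, because the minibatch
  takes finitely many values and can be handled piecewise.\<close>

lemma measurable_batch:
  assumes "\<And>b. b \<in> minibatches net D \<Longrightarrow> g b \<in> (\<Pi>\<^sub>M l\<in>{1..depth net}. S l) \<rightarrow>\<^sub>M N"
  shows "(\<lambda>\<omega>. g (B \<omega>) (noise \<omega>)) \<in> M \<rightarrow>\<^sub>M N"
  using measurable_compose[OF measurable_noise assms] measurable_B
    countable_finite[OF finite_minibatches[OF finite_D]]
  by (rule measurable_compose_countable')

text \<open>On the event that the minibatch equals \<open>b\<close> the integrand is
  \<open>g b (noise \<omega>)\<close>. The indicator of that event is independent of the noise, so
  each summand factorizes and integrability for frozen minibatches is enough.\<close>

lemma
  fixes g :: "'y minibatch \<Rightarrow> (nat \<Rightarrow> 'z) \<Rightarrow> real"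
  assumes meas: "\<And>b. b \<in> minibatches net D \<Longrightarrow> g b \<in> borel_measurable (\<Pi>\<^sub>M l\<in>{1..depth net}. S l)"
    and int: "\<And>b. b \<in> minibatches net D \<Longrightarrow> integrable M (\<lambda>\<omega>. g b (noise \<omega>))"
  shows integrable_batch: "integrable M (\<lambda>\<omega>. g (B \<omega>) (noise \<omega>))"
    and expectation_batch: "expectation (\<lambda>\<omega>. g (B \<omega>) (noise \<omega>)) =
      (\<Sum>b\<in>minibatches net D.
        expectation (\<lambda>\<omega>. indicator {b} (B \<omega>)) * expectation (\<lambda>\<omega>. g b (noise \<omega>)))"
proof -
  let ?MB = "minibatches net D"
  have ind: "indep_var borel (\<lambda>\<omega>. indicat_real {b} (B \<omega>)) borel (\<lambda>\<omega>. g b (noise \<omega>))"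
    if "b \<in> ?MB" for b
    by (rule indep_batch_noise[OF _ meas[OF that]]) simp
  have intB: "integrable M (\<lambda>\<omega>. indicat_real {b} (B \<omega>))" for b
    using measurable_compose[OF measurable_B, of "indicat_real {b}" borel]
    by (intro integrable_const_bound[of _ 1]) (auto simp: indicator_def)
  have int': "integrable M (\<lambda>\<omega>. indicat_real {b} (B \<omega>) * g b (noise \<omega>))" if "b \<in> ?MB" for b
    using indep_var_integrable[OF ind intB int] that by simp
  have eq: "g (B \<omega>) (noise \<omega>) = (\<Sum>b\<in>?MB. indicat_real {b} (B \<omega>) * g b (noise \<omega>))"
    if "\<omega> \<in> space M" for \<omega>
  proof -
    have "B \<omega> \<in> ?MB"
      using measurable_space[OF measurable_B that] by simp
    then show ?thesis
      using finite_minibatches[OF finite_D]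
      by (simp add: indicator_def of_bool_def if_distrib if_distribR cong: if_cong)
  qed
  have "integrable M (\<lambda>\<omega>. \<Sum>b\<in>?MB. indicat_real {b} (B \<omega>) * g b (noise \<omega>))"
    using int' by (rule Bochner_Integration.integrable_sum)
  then show "integrable M (\<lambda>\<omega>. g (B \<omega>) (noise \<omega>))"
    using eq by (subst Bochner_Integration.integrable_cong[OF refl]) auto
  have "expectation (\<lambda>\<omega>. g (B \<omega>) (noise \<omega>))
      = expectation (\<lambda>\<omega>. \<Sum>b\<in>?MB. indicat_real {b} (B \<omega>) * g b (noise \<omega>))"
    using eq by (rule Bochner_Integration.integral_cong[OF refl])
  also have "\<dots> = (\<Sum>b\<in>?MB. expectation (\<lambda>\<omega>. indicat_real {b} (B \<omega>) * g b (noise \<omega>)))"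
    using int' by (rule Bochner_Integration.integral_sum)
  also have "\<dots> = (\<Sum>b\<in>?MB.
      expectation (\<lambda>\<omega>. indicator {b} (B \<omega>)) * expectation (\<lambda>\<omega>. g b (noise \<omega>)))"
    using indep_var_lebesgue_integral[OF ind intB int] by (intro sum.cong) auto
  finally show "expectation (\<lambda>\<omega>. g (B \<omega>) (noise \<omega>)) = \<dots>" .
qed

text \<open>The quantizer hypotheses speak about the law of \<open>\<xi> l\<close>; here they are
  moved to \<open>M\<close>. First moments exist because a square-integrable function on a
  probability space is integrable.\<close>

lemma
  assumes l: "l \<in> {1..depth net}" and x: "x \<in> cidx net l \<rightarrow>\<^sub>E UNIV" and k: "k \<in> cidx net l"
  shows measurable_Q: "(\<lambda>z. Q l z x k) \<in> borel_measurable (S l)"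
    and square_integrable_Q: "integrable M (\<lambda>\<omega>. (Q l (\<xi> l \<omega>) x k)\<^sup>2)"
    and integrable_Q: "integrable M (\<lambda>\<omega>. Q l (\<xi> l \<omega>) x k)"
    and expectation_Q: "expectation (\<lambda>\<omega>. Q l (\<xi> l \<omega>) x k) = x k"
proof -
  have q: "(\<lambda>z. Q l z x) \<in> distr M (S l) (\<xi> l) \<rightarrow>\<^sub>M (\<Pi>\<^sub>M i\<in>cidx net l. borel)"
    "integrable (distr M (S l) (\<xi> l)) (\<lambda>z. (Q l z x k)\<^sup>2)"
    "(\<integral>z. Q l z x k \<partial>distr M (S l) (\<xi> l)) = x k"
    using quantizer[OF l] x k unfolding unbiased_quantizer_def by blast+
  note [measurable] = measurable_xi[OF l]
  show m[measurable]: "(\<lambda>z. Q l z x k) \<in> borel_measurable (S l)"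
    using measurable_compose[OF q(1) measurable_component_singleton[OF k]] by simp
  show i2: "integrable M (\<lambda>\<omega>. (Q l (\<xi> l \<omega>) x k)\<^sup>2)"
    using q(2) by (subst (asm) integrable_distr_eq) auto
  show "integrable M (\<lambda>\<omega>. Q l (\<xi> l \<omega>) x k)"
    by (rule square_integrable_imp_integrable[OF _ i2]) simp
  show "expectation (\<lambda>\<omega>. Q l (\<xi> l \<omega>) x k) = x k"
    using q(3) by (subst (asm) integral_distr) auto
qed

lemma measurable_hat_ctx:
  assumes "l \<in> {1..depth net}" "l \<in> J" "k \<in> cidx net l"
  shows "(\<lambda>z. hat_ctx net \<theta> Q b z l k) \<in> borel_measurable (\<Pi>\<^sub>M l\<in>J. S l)"
  unfolding hat_ctx_def
  using measurable_compose[OF measurable_component_singleton[OF assms(2), where M = S]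
      measurable_Q[OF assms(1) ctx_of_PiE assms(3)]] .

lemma hat_H_less:
  assumes "m < depth net" "ij \<in> fidx net m"
  shows "hat_H m b z ij =
    (\<Sum>kp\<in>fidx net (Suc m). hat_ctx net \<theta> Q b z (Suc m) (kp, Inl ij) * hat_H (Suc m) b z kp)"
  using assms by (simp add: hat_H_def hat_grad_H_less G_H_def)

text \<open>The gradient with respect to the output of layer \<open>m\<close> has passed only
  through contexts of layers strictly above \<open>m\<close>. This strictness is what separates it
  from the noise of layer \<open>m\<close>.\<close>

lemma hat_H_cong:
  assumes "m \<le> depth net" "\<And>j. m < j \<Longrightarrow> j \<le> depth net \<Longrightarrow> z j = z' j"
  shows "hat_H m b z = hat_H m b z'"
  unfolding hat_H_def using assms by (intro hat_grad_H_cong) (auto simp: hat_ctx_def)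

text \<open>\<open>J\<close> is kept general for two uses: \<open>{1..depth net}\<close> for
  measurability in the whole noise, and \<open>{Suc m..depth net}\<close> for independence from the
  noise of layer \<open>m\<close>.\<close>

lemma measurable_hat_H:
  assumes "m \<le> depth net" "{Suc m..depth net} \<subseteq> J" "ij \<in> fidx net m"
  shows "(\<lambda>z. hat_H m b z ij) \<in> borel_measurable (\<Pi>\<^sub>M l\<in>J. S l)"
  using assms
proof (induction arbitrary: ij rule: inc_induct)
  case base
  then show ?case
    by (simp add: hat_H_def hat_grad_H_depth)
next
  case (step m)
  have "(\<lambda>z. \<Sum>kp\<in>fidx net (Suc m).
      hat_ctx net \<theta> Q b z (Suc m) (kp, Inl ij) * hat_H (Suc m) b z kp)
      \<in> borel_measurable (\<Pi>\<^sub>M l\<in>J. S l)"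
    using step.prems step.hyps
    by (intro borel_measurable_sum borel_measurable_times measurable_hat_ctx step.IH) auto
  then show ?case
    using step by (simp add: hat_H_less)
qed

text \<open>\<open>{m}\<close> and \<open>{Suc m..depth net}\<close> are disjoint blocks of an
  independent family.\<close>

lemma indep_noise_later:
  assumes m: "m \<in> {1..depth net}" and q: "q \<in> S m \<rightarrow>\<^sub>M N1"
    and h: "h \<in> (\<Pi>\<^sub>M l\<in>{Suc m..depth net}. S l) \<rightarrow>\<^sub>M N2"
  shows "indep_var N1 (\<lambda>\<omega>. q (\<xi> m \<omega>)) N2 (\<lambda>\<omega>. h (restrict (noise \<omega>) {Suc m..depth net}))"
proof -
  have ind: "indep_var (PiM {m} S) (\<lambda>\<omega>. restrict (\<lambda>l. \<xi> l \<omega>) {m})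
      (PiM {Suc m..depth net} S) (\<lambda>\<omega>. restrict (\<lambda>l. \<xi> l \<omega>) {Suc m..depth net})"
    using m by (intro indep_var_restrict[OF noise_indep]) auto
  have "(\<lambda>x. q (x m)) \<in> PiM {m} S \<rightarrow>\<^sub>M N1"
    by (rule measurable_compose[OF measurable_component_singleton[where M = S] q]) simp
  from indep_var_compose[OF ind this h]
  have "indep_var N1 (\<lambda>\<omega>. q (\<xi> m \<omega>)) N2 (\<lambda>\<omega>. h (restrict (\<lambda>l. \<xi> l \<omega>) {Suc m..depth net}))"
    by (simp add: comp_def)
  moreover have "restrict (\<lambda>l. \<xi> l \<omega>) {Suc m..depth net} = restrict (noise \<omega>) {Suc m..depth net}" for \<omega>
    by (auto simp: noise_def restrict_def)
  ultimately show ?thesis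
    by simp
qed

text \<open>The hypothesis \<open>cong\<close> says that \<open>h\<close> reads only the noise above
  layer \<open>m\<close>, which makes it independent of the quantized context of that layer.
  Expectations then factorize, and unbiasedness replaces the context by its exact value; squares of
  independent variables are independent too, which yields the second moment.\<close>

lemma
  fixes h :: "(nat \<Rightarrow> 'z) \<Rightarrow> real"
  assumes m: "m \<in> {1..depth net}" and k: "k \<in> cidx net m"
    and h: "h \<in> borel_measurable (\<Pi>\<^sub>M l\<in>{Suc m..depth net}. S l)"
    and cong: "\<And>z. h (restrict z {Suc m..depth net}) = h z"
  shows integrable_hat_ctx_times: "integrable M (\<lambda>\<omega>. h (noise \<omega>)) \<Longrightarrow>
      integrable M (\<lambda>\<omega>. hat_ctx net \<theta> Q b (noise \<omega>) m k * h (noise \<omega>))"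
    and expectation_hat_ctx_times: "integrable M (\<lambda>\<omega>. h (noise \<omega>)) \<Longrightarrow>
      expectation (\<lambda>\<omega>. hat_ctx net \<theta> Q b (noise \<omega>) m k * h (noise \<omega>)) =
        ctx_of net \<theta> b m k * expectation (\<lambda>\<omega>. h (noise \<omega>))"
    and square_integrable_hat_ctx_times: "integrable M (\<lambda>\<omega>. (h (noise \<omega>))\<^sup>2) \<Longrightarrow>
      integrable M (\<lambda>\<omega>. (hat_ctx net \<theta> Q b (noise \<omega>) m k * h (noise \<omega>))\<^sup>2)"
proof -
  let ?q = "\<lambda>z. Q m z (ctx_of net \<theta> b m) k"
  note q = measurable_Q[OF m ctx_of_PiE k] square_integrable_Q[OF m ctx_of_PiE k]
    integrable_Q[OF m ctx_of_PiE k] expectation_Q[OF m ctx_of_PiE k]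
  have eq: "hat_ctx net \<theta> Q b (noise \<omega>) m k = ?q (\<xi> m \<omega>)" for \<omega>
    using m by (simp add: hat_ctx_def noise_def)
  have ind: "indep_var borel (\<lambda>\<omega>. ?q (\<xi> m \<omega>)) borel (\<lambda>\<omega>. h (noise \<omega>))"
    using indep_noise_later[OF m q(1) h] by (simp add: cong)
  have ind2: "indep_var borel (\<lambda>\<omega>. (?q (\<xi> m \<omega>))\<^sup>2) borel (\<lambda>\<omega>. (h (noise \<omega>))\<^sup>2)"
    using indep_var_compose[OF ind, of "\<lambda>x. x\<^sup>2" borel "\<lambda>x. x\<^sup>2" borel] by (simp add: comp_def)
  show "integrable M (\<lambda>\<omega>. hat_ctx net \<theta> Q b (noise \<omega>) m k * h (noise \<omega>))"
    if "integrable M (\<lambda>\<omega>. h (noise \<omega>))"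
    unfolding eq by (rule indep_var_integrable[OF ind q(3) that])
  show "expectation (\<lambda>\<omega>. hat_ctx net \<theta> Q b (noise \<omega>) m k * h (noise \<omega>)) =
      ctx_of net \<theta> b m k * expectation (\<lambda>\<omega>. h (noise \<omega>))"
    if "integrable M (\<lambda>\<omega>. h (noise \<omega>))"
    unfolding eq using indep_var_lebesgue_integral[OF ind q(3) that] q(4) by simp
  show "integrable M (\<lambda>\<omega>. (hat_ctx net \<theta> Q b (noise \<omega>) m k * h (noise \<omega>))\<^sup>2)"
    if "integrable M (\<lambda>\<omega>. (h (noise \<omega>))\<^sup>2)"
    unfolding eq power_mult_distrib by (rule indep_var_integrable[OF ind2 q(2) that])
qed

lemma hat_H_restrict:
  "m \<le> depth net \<Longrightarrow> hat_H m b (restrict z {Suc m..depth net}) = hat_H m b z"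
  by (rule hat_H_cong) auto

text \<open>Downward induction. At the output layer the gradient is constant for a frozen minibatch;
  each further step is a finite sum of products of independent square-integrable factors.\<close>

lemma square_integrable_hat_H:
  assumes "m \<le> depth net" "ij \<in> fidx net m"
  shows "integrable M (\<lambda>\<omega>. (hat_H m b (noise \<omega>) ij)\<^sup>2)"
  using assms
proof (induction arbitrary: ij rule: inc_induct)
  case base
  then show ?case
    by (simp add: hat_H_def hat_grad_H_depth)
next
  case (step m)
  have "integrable M (\<lambda>\<omega>. (\<Sum>kp\<in>fidx net (Suc m).
      hat_ctx net \<theta> Q b (noise \<omega>) (Suc m) (kp, Inl ij) * hat_H (Suc m) b (noise \<omega>) kp)\<^sup>2)"
  proof (intro square_integrable_sum)
    fix kp assume kp: "kp \<in> fidx net (Suc m)"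
    have k: "(kp, Inl ij) \<in> cidx net (Suc m)"
      using kp step.prems by (rule cidx_SucI)
    show "(\<lambda>\<omega>. hat_ctx net \<theta> Q b (noise \<omega>) (Suc m) (kp, Inl ij) * hat_H (Suc m) b (noise \<omega>) kp)
        \<in> borel_measurable M"
      using kp k step.hyps
      by (intro borel_measurable_times measurable_compose[OF measurable_noise]
          measurable_hat_ctx measurable_hat_H) auto
    show "integrable M (\<lambda>\<omega>. (hat_ctx net \<theta> Q b (noise \<omega>) (Suc m) (kp, Inl ij)
        * hat_H (Suc m) b (noise \<omega>) kp)\<^sup>2)"
      using kp k step.hyps step.IH
      by (intro square_integrable_hat_ctx_times[where h = "\<lambda>z. hat_H (Suc m) b z kp"]
          measurable_hat_H) (auto simp: hat_H_restrict)
  qed simp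
  then show ?case
    using step by (simp add: hat_H_less)
qed

lemma integrable_hat_H:
  assumes "m \<le> depth net" "ij \<in> fidx net m"
  shows "integrable M (\<lambda>\<omega>. hat_H m b (noise \<omega>) ij)"
  using assms measurable_compose[OF measurable_noise measurable_hat_H]
  by (intro square_integrable_imp_integrable[OF _ square_integrable_hat_H]) auto

subsection \<open>Conditional variance given minibatch and gradient\<close>

text \<open>Flattens the bilinear form to one sum over context entries. The weights depend on
  \<open>b\<close> but neither on \<open>v\<close> nor on \<open>c'\<close>, so the same weights
  serve the quantized and the exact context, and they are constants once the minibatch is
  frozen.\<close>

lemma ex_context_weights:
  assumes "l \<le> m" "i \<in> pidx net l"
  shows "\<exists>a. \<forall>b v c'. G_Theta_between net (ctx_of net \<theta> b) l m v c' i =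
    (\<Sum>k\<in>cidx net m. a b k * (c' k * v (fst k)))"
proof -
  have "\<exists>a. \<forall>v c'. G_Theta_between net (ctx_of net \<theta> b) l m v c' i =
    (\<Sum>k\<in>cidx net m. a k * (c' k * v (fst k)))" for b
  proof -
    obtain a where a: "\<And>v c'. G_Theta_between net (ctx_of net \<theta> b) l m v c' i =
      (\<Sum>s\<in>fidx net (m - 1) <+> pidx net m. a s * (\<Sum>kp\<in>fidx net m. c' (kp, s) * v kp))"
      using G_Theta_between_linear[OF assms, of "ctx_of net \<theta> b"] by blast
    have "G_Theta_between net (ctx_of net \<theta> b) l m v c' i =
      (\<Sum>k\<in>cidx net m. a (snd k) * (c' k * v (fst k)))" for v c'
      unfolding a cidx_def sum_distrib_left
      by (subst sum.swap) (simp add: sum.cartesian_product split_beta)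
    then show ?thesis
      by (intro exI[of _ "\<lambda>k. a (snd k)"]) blast
  qed
  then show ?thesis
    by (intro choice allI)
qed

lemma measurable_mixed_grad:
  assumes "l \<le> m" "m \<in> {1..depth net}" "i \<in> pidx net l"
  shows "(\<lambda>z. mixed_grad l m b z i) \<in> borel_measurable (\<Pi>\<^sub>M l\<in>{1..depth net}. S l)"
proof -
  obtain a where a: "\<And>b v c'. G_Theta_between net (ctx_of net \<theta> b) l m v c' i =
      (\<Sum>k\<in>cidx net m. a b k * (c' k * v (fst k)))"
    using ex_context_weights[OF assms(1,3)] by blast
  show ?thesis
    unfolding mixed_grad_def a using assms(2)
    by (intro borel_measurable_sum borel_measurable_times borel_measurable_const
        measurable_hat_ctx measurable_hat_H) auto
qed

lemma measurable_mean_grad: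
  assumes "l \<le> m" "m \<in> {1..depth net}" "i \<in> pidx net l"
  shows "(\<lambda>z. mean_grad l m b z i) \<in> borel_measurable (\<Pi>\<^sub>M l\<in>{1..depth net}. S l)"
proof -
  obtain a where a: "\<And>b v c'. G_Theta_between net (ctx_of net \<theta> b) l m v c' i =
      (\<Sum>k\<in>cidx net m. a b k * (c' k * v (fst k)))"
    using ex_context_weights[OF assms(1,3)] by blast
  show ?thesis
    unfolding mean_grad_def a using assms(2)
    by (intro borel_measurable_sum borel_measurable_times borel_measurable_const
        measurable_hat_H) auto
qed

text \<open>For a frozen minibatch the entry is a fixed linear combination of products of a
  quantized context entry and an independent gradient entry.\<close>

lemma square_integrable_mixed_grad:
  assumes "l \<le> m" "m \<in> {1..depth net}" "i \<in> pidx net l"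
  shows "integrable M (\<lambda>\<omega>. (mixed_grad l m (B \<omega>) (noise \<omega>) i)\<^sup>2)"
proof (rule integrable_batch)
  fix b
  show "(\<lambda>z. (mixed_grad l m b z i)\<^sup>2) \<in> borel_measurable (\<Pi>\<^sub>M l\<in>{1..depth net}. S l)"
    using measurable_mixed_grad[OF assms] by simp
  obtain a where a: "\<And>b v c'. G_Theta_between net (ctx_of net \<theta> b) l m v c' i =
      (\<Sum>k\<in>cidx net m. a b k * (c' k * v (fst k)))"
    using ex_context_weights[OF assms(1,3)] by blast
  show "integrable M (\<lambda>\<omega>. (mixed_grad l m b (noise \<omega>) i)\<^sup>2)"
    unfolding mixed_grad_def a
  proof (intro square_integrable_sum)
    fix k assume k: "k \<in> cidx net m"
    show "(\<lambda>\<omega>. a b k * (hat_ctx net \<theta> Q b (noise \<omega>) m k * hat_H m b (noise \<omega>) (fst k)))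
        \<in> borel_measurable M"
      using k assms(2)
      by (intro borel_measurable_times measurable_compose[OF measurable_noise]
          measurable_hat_ctx measurable_hat_H borel_measurable_const) auto
    have "integrable M (\<lambda>\<omega>. (hat_ctx net \<theta> Q b (noise \<omega>) m k * hat_H m b (noise \<omega>) (fst k))\<^sup>2)"
      using k assms(2)
      by (intro square_integrable_hat_ctx_times[where h = "\<lambda>z. hat_H m b z (fst k)"]
          measurable_hat_H square_integrable_hat_H) (auto simp: hat_H_restrict)
    then show "integrable M
        (\<lambda>\<omega>. (a b k * (hat_ctx net \<theta> Q b (noise \<omega>) m k * hat_H m b (noise \<omega>) (fst k)))\<^sup>2)"
      unfolding power_mult_distrib[of "a b k"] by (rule integrable_mult_right)
  qed simp
qed

lemma square_integrable_mean_grad: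
  assumes "l \<le> m" "m \<in> {1..depth net}" "i \<in> pidx net l"
  shows "integrable M (\<lambda>\<omega>. (mean_grad l m (B \<omega>) (noise \<omega>) i)\<^sup>2)"
proof (rule integrable_batch)
  fix b
  show "(\<lambda>z. (mean_grad l m b z i)\<^sup>2) \<in> borel_measurable (\<Pi>\<^sub>M l\<in>{1..depth net}. S l)"
    using measurable_mean_grad[OF assms] by simp
  obtain a where a: "\<And>b v c'. G_Theta_between net (ctx_of net \<theta> b) l m v c' i =
      (\<Sum>k\<in>cidx net m. a b k * (c' k * v (fst k)))"
    using ex_context_weights[OF assms(1,3)] by blast
  show "integrable M (\<lambda>\<omega>. (mean_grad l m b (noise \<omega>) i)\<^sup>2)"
    unfolding mean_grad_def a
  proof (intro square_integrable_sum)
    fix k assume k: "k \<in> cidx net m"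
    show "(\<lambda>\<omega>. a b k * (ctx_of net \<theta> b m k * hat_H m b (noise \<omega>) (fst k))) \<in> borel_measurable M"
      using k assms(2)
      by (intro borel_measurable_times measurable_compose[OF measurable_noise]
          measurable_hat_H borel_measurable_const) auto
    have "integrable M (\<lambda>\<omega>. (hat_H m b (noise \<omega>) (fst k))\<^sup>2)"
      using k assms(2) fst_cidx by (intro square_integrable_hat_H) auto
    then show "integrable M (\<lambda>\<omega>. (a b k * (ctx_of net \<theta> b m k * hat_H m b (noise \<omega>) (fst k)))\<^sup>2)"
      unfolding power_mult_distrib by (intro integrable_mult_right)
  qed simp
qed

lemma
  assumes "l \<le> m" "m \<in> {1..depth net}" "i \<in> pidx net l"
  shows integrable_mixed_grad: "integrable M (\<lambda>\<omega>. mixed_grad l m (B \<omega>) (noise \<omega>) i)"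
    and integrable_mean_grad: "integrable M (\<lambda>\<omega>. mean_grad l m (B \<omega>) (noise \<omega>) i)"
  using square_integrable_mixed_grad[OF assms] square_integrable_mean_grad[OF assms]
    measurable_batch[OF measurable_mixed_grad[OF assms]]
    measurable_batch[OF measurable_mean_grad[OF assms]]
  by (auto intro: square_integrable_imp_integrable)

lemma hat_H_eq_restrict:
  "m \<le> depth net \<Longrightarrow> hat_H m b z = (\<lambda>ij\<in>fidx net m. hat_H m b z ij)"
  unfolding hat_H_def by (rule PiE_restrict[OF hat_grad_H_PiE, symmetric])

lemma measurable_hat_H_PiM:
  assumes "m \<le> depth net" "{Suc m..depth net} \<subseteq> J"
  shows "hat_H m b \<in> (\<Pi>\<^sub>M l\<in>J. S l) \<rightarrow>\<^sub>M (\<Pi>\<^sub>M ij\<in>fidx net m. borel)"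
proof -
  have "(\<lambda>z. \<lambda>ij\<in>fidx net m. hat_H m b z ij) \<in> (\<Pi>\<^sub>M l\<in>J. S l) \<rightarrow>\<^sub>M (\<Pi>\<^sub>M ij\<in>fidx net m. borel)"
    by (intro measurable_restrict measurable_hat_H assms)
  then show ?thesis
    by (simp only: hat_H_eq_restrict[OF assms(1), symmetric])
qed

lemma measurable_cond_pair:
  assumes "m \<le> depth net"
  shows "(\<lambda>\<omega>. (B \<omega>, hat_H m (B \<omega>) (noise \<omega>))) \<in>
    M \<rightarrow>\<^sub>M count_space (minibatches net D) \<Otimes>\<^sub>M (\<Pi>\<^sub>M kp\<in>fidx net m. borel)"
proof -
  have "hat_H m b \<in> (\<Pi>\<^sub>M l\<in>{1..depth net}. S l) \<rightarrow>\<^sub>M (\<Pi>\<^sub>M ij\<in>fidx net m. borel)" for b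
    using assms by (intro measurable_hat_H_PiM) auto
  from measurable_batch[OF this] show ?thesis
    by (intro measurable_Pair measurable_B)
qed

lemma space_cond_algebra [simp]: "space (cond_algebra m) = space M"
  by (simp add: cond_algebra_def batch_grad_algebra_def)

lemma sets_cond_algebra:
  assumes "m \<le> depth net"
  shows "sets (cond_algebra m) = {(\<lambda>\<omega>. (B \<omega>, hat_H m (B \<omega>) (noise \<omega>))) -` U \<inter> space M |U.
    U \<in> sets (count_space (minibatches net D) \<Otimes>\<^sub>M (\<Pi>\<^sub>M kp\<in>fidx net m. borel))}"
  unfolding cond_algebra_def batch_grad_algebra_def
  using measurable_space[OF measurable_cond_pair[OF assms]] by (intro sets_vimage_algebra2) auto

lemma subalgebra_cond_algebra:
  assumes "m \<le> depth net"
  shows "subalgebra M (cond_algebra m)"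
  unfolding subalgebra_def sets_cond_algebra[OF assms]
  using measurable_sets[OF measurable_cond_pair[OF assms]] by auto

text \<open>For each fixed minibatch this is a linear function of the conditioning gradient. The
  minibatch is itself measurable for the conditioning algebra, so choosing the weights according to
  it preserves measurability.\<close>

lemma measurable_mean_grad_cond_algebra:
  assumes "l \<le> m" "m \<in> {1..depth net}" "i \<in> pidx net l"
  shows "(\<lambda>\<omega>. mean_grad l m (B \<omega>) (noise \<omega>) i) \<in> borel_measurable (cond_algebra m)"
proof -
  have m: "m \<le> depth net"
    using assms by simp
  obtain a where a: "\<And>b v c'. G_Theta_between net (ctx_of net \<theta> b) l m v c' i =
      (\<Sum>k\<in>cidx net m. a b k * (c' k * v (fst k)))"
    using ex_context_weights[OF assms(1,3)] by blast
  have pair: "(\<lambda>\<omega>. (B \<omega>, hat_H m (B \<omega>) (noise \<omega>))) \<in> cond_algebra m \<rightarrow>\<^sub>M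
      count_space (minibatches net D) \<Otimes>\<^sub>M (\<Pi>\<^sub>M kp\<in>fidx net m. borel)"
    unfolding cond_algebra_def batch_grad_algebra_def
    using measurable_space[OF measurable_cond_pair[OF m]] by (intro measurable_vimage_algebra1) auto
  have B: "B \<in> cond_algebra m \<rightarrow>\<^sub>M count_space (minibatches net D)"
    and H: "(\<lambda>\<omega>. hat_H m (B \<omega>) (noise \<omega>)) \<in> cond_algebra m \<rightarrow>\<^sub>M (\<Pi>\<^sub>M kp\<in>fidx net m. borel)"
    using measurable_compose[OF pair measurable_fst] measurable_compose[OF pair measurable_snd]
    by simp_all
  have Hk: "(\<lambda>\<omega>. hat_H m (B \<omega>) (noise \<omega>) kp) \<in> borel_measurable (cond_algebra m)"
    if "kp \<in> fidx net m" for kp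
    using measurable_compose[OF H measurable_component_singleton[OF that]] by simp
  have "(\<lambda>\<omega>. (\<Sum>k\<in>cidx net m. a b k * (ctx_of net \<theta> b m k * hat_H m (B \<omega>) (noise \<omega>) (fst k))))
      \<in> borel_measurable (cond_algebra m)" for b
    using Hk
    by (intro borel_measurable_sum borel_measurable_times borel_measurable_const) auto
  from measurable_compose_countable'[OF this B countable_finite[OF finite_minibatches[OF finite_D]]]
  show ?thesis
    unfolding mean_grad_def a .
qed

text \<open>The averaging property of the conditional expectation. With the minibatch frozen, the
  indicator of the event is a function of \<open>hat_H m b z\<close>, hence of the noise above layer
  \<open>m\<close>; it can be absorbed into the factor that is independent of the quantized
  context.\<close>

lemma mixed_grad_cond_integral:
  assumes "l \<le> m" "m \<in> {1..depth net}" "i \<in> pidx net l" "A \<in> sets (cond_algebra m)"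
  shows "(\<integral>\<omega>\<in>A. mixed_grad l m (B \<omega>) (noise \<omega>) i \<partial>M) =
    (\<integral>\<omega>\<in>A. mean_grad l m (B \<omega>) (noise \<omega>) i \<partial>M)"
proof -
  have m: "m \<le> depth net"
    using assms by simp
  obtain U where U: "U \<in> sets (count_space (minibatches net D) \<Otimes>\<^sub>M (\<Pi>\<^sub>M kp\<in>fidx net m. borel))"
    and A: "A = (\<lambda>\<omega>. (B \<omega>, hat_H m (B \<omega>) (noise \<omega>))) -` U \<inter> space M"
    using assms(4) unfolding sets_cond_algebra[OF m] by blast
  obtain a where a: "\<And>b v c'. G_Theta_between net (ctx_of net \<theta> b) l m v c' i =
      (\<Sum>k\<in>cidx net m. a b k * (c' k * v (fst k)))"
    using ex_context_weights[OF assms(1,3)] by blast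
  \<comment> \<open>A gradient entry cut off to the event. It is dominated by the entry itself and
    still reads only the noise above layer \<open>m\<close>.\<close>
  define h where "h b kp z = indicat_real U (b, hat_H m b z) * hat_H m b z kp" for b kp z
  have ind: "(\<lambda>z. indicat_real U (b, hat_H m b z)) \<in> borel_measurable (\<Pi>\<^sub>M l\<in>J. S l)"
    if "b \<in> minibatches net D" "{Suc m..depth net} \<subseteq> J" for b J
  proof -
    have "(\<lambda>z. (b, hat_H m b z)) \<in> (\<Pi>\<^sub>M l\<in>J. S l) \<rightarrow>\<^sub>M
        count_space (minibatches net D) \<Otimes>\<^sub>M (\<Pi>\<^sub>M kp\<in>fidx net m. borel)"
      using that measurable_hat_H_PiM[OF m that(2)] by (intro measurable_Pair) auto
    from measurable_compose[OF this borel_measurable_indicator[OF U]] show ?thesis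
      by simp
  qed
  have h_meas: "h b kp \<in> borel_measurable (\<Pi>\<^sub>M l\<in>J. S l)"
    if "b \<in> minibatches net D" "kp \<in> fidx net m" "{Suc m..depth net} \<subseteq> J" for b kp J
    unfolding h_def using that ind m by (intro borel_measurable_times measurable_hat_H) auto
  have h_int: "integrable M (\<lambda>\<omega>. h b kp (noise \<omega>))"
    if b: "b \<in> minibatches net D" and kp: "kp \<in> fidx net m" for b kp
  proof (rule Bochner_Integration.integrable_bound[OF integrable_hat_H[OF m kp, of b]])
    show "(\<lambda>\<omega>. h b kp (noise \<omega>)) \<in> borel_measurable M"
      using m by (intro measurable_compose[OF measurable_noise h_meas[OF b kp]]) auto
  qed (auto simp: h_def indicator_def)
  have h_cong: "h b kp (restrict z {Suc m..depth net}) = h b kp z" for b kp z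
    by (simp add: h_def hat_H_restrict[OF m])
  \<comment> \<open>The context is left as a parameter \<open>c'\<close>, so that the quantized and
    the exact integrand are two instances with one common expansion.\<close>
  define g where "g c' b z = indicat_real U (b, hat_H m b z) *
      G_Theta_between net (ctx_of net \<theta> b) l m (hat_H m b z) (c' b z) i"
    for c' :: "'y minibatch \<Rightarrow> (nat \<Rightarrow> 'z) \<Rightarrow> ctx" and b z
  have g: "g c' b z = (\<Sum>k\<in>cidx net m. a b k * (c' b z k * h b (fst k) z))" for c' b z
    unfolding g_def a h_def sum_distrib_left by (intro sum.cong) auto
  let ?q = "\<lambda>b z. hat_ctx net \<theta> Q b z m" and ?x = "\<lambda>b z. ctx_of net \<theta> b m"
  have q_int: "integrable M (\<lambda>\<omega>. a b k * (?q b (noise \<omega>) k * h b (fst k) (noise \<omega>)))"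
    and x_int: "integrable M (\<lambda>\<omega>. a b k * (?x b (noise \<omega>) k * h b (fst k) (noise \<omega>)))"
    if "b \<in> minibatches net D" "k \<in> cidx net m" for b k
    using integrable_hat_ctx_times[OF assms(2) that(2)
        h_meas[OF that(1) fst_cidx[OF that(2)] subset_refl] h_cong]
      h_int[OF that(1) fst_cidx[OF that(2)]]
    by auto
  have g_eq: "expectation (\<lambda>\<omega>. g ?q b (noise \<omega>)) = expectation (\<lambda>\<omega>. g ?x b (noise \<omega>))"
    if b: "b \<in> minibatches net D" for b
  proof -
    have "expectation (\<lambda>\<omega>. g ?q b (noise \<omega>)) =
        (\<Sum>k\<in>cidx net m. a b k * expectation (\<lambda>\<omega>. ?q b (noise \<omega>) k * h b (fst k) (noise \<omega>)))"
      unfolding g using q_int[OF b] by (subst Bochner_Integration.integral_sum) auto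
    also have "\<dots> = (\<Sum>k\<in>cidx net m. a b k * (ctx_of net \<theta> b m k * expectation (\<lambda>\<omega>. h b (fst k) (noise \<omega>))))"
    proof (intro sum.cong refl arg_cong[where f = "\<lambda>y. _ * y"])
      fix k assume k: "k \<in> cidx net m"
      show "expectation (\<lambda>\<omega>. ?q b (noise \<omega>) k * h b (fst k) (noise \<omega>)) =
          ctx_of net \<theta> b m k * expectation (\<lambda>\<omega>. h b (fst k) (noise \<omega>))"
        by (rule expectation_hat_ctx_times[OF assms(2) k
            h_meas[OF b fst_cidx[OF k] subset_refl] h_cong h_int[OF b fst_cidx[OF k]]])
    qed
    also have "\<dots> = expectation (\<lambda>\<omega>. g ?x b (noise \<omega>))"
      unfolding g using x_int[OF b] by (subst Bochner_Integration.integral_sum) auto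
    finally show ?thesis .
  qed
  have ind': "(\<lambda>z. indicat_real U (b, hat_H m b z)) \<in> borel_measurable (\<Pi>\<^sub>M l\<in>{1..depth net}. S l)"
    if "b \<in> minibatches net D" for b
    using ind[OF that, of "{1..depth net}"] by simp
  have q_meas: "g ?q b \<in> borel_measurable (\<Pi>\<^sub>M l\<in>{1..depth net}. S l)"
    and x_meas: "g ?x b \<in> borel_measurable (\<Pi>\<^sub>M l\<in>{1..depth net}. S l)"
    if "b \<in> minibatches net D" for b
    using borel_measurable_times[OF ind'[OF that] measurable_mixed_grad[OF assms(1-3), of b]]
      borel_measurable_times[OF ind'[OF that] measurable_mean_grad[OF assms(1-3), of b]]
    by (simp_all add: g_def[abs_def] mixed_grad_def mean_grad_def)
  have q_g: "integrable M (\<lambda>\<omega>. g ?q b (noise \<omega>))"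
    and x_g: "integrable M (\<lambda>\<omega>. g ?x b (noise \<omega>))" if "b \<in> minibatches net D" for b
    unfolding g by (rule Bochner_Integration.integrable_sum, erule q_int[OF that] x_int[OF that])+
  have A_ind: "indicat_real A \<omega> = indicat_real U (B \<omega>, hat_H m (B \<omega>) (noise \<omega>))"
    if "\<omega> \<in> space M" for \<omega>
    using that by (simp add: A indicator_def)
  have "(\<integral>\<omega>\<in>A. mixed_grad l m (B \<omega>) (noise \<omega>) i \<partial>M) = expectation (\<lambda>\<omega>. g ?q (B \<omega>) (noise \<omega>))"
    unfolding set_lebesgue_integral_def g_def mixed_grad_def
    by (intro Bochner_Integration.integral_cong refl) (simp add: A_ind)
  also have "\<dots> = expectation (\<lambda>\<omega>. g ?x (B \<omega>) (noise \<omega>))"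
    using expectation_batch[of "g ?q", OF q_meas q_g] expectation_batch[of "g ?x", OF x_meas x_g] g_eq by simp
  also have "\<dots> = (\<integral>\<omega>\<in>A. mean_grad l m (B \<omega>) (noise \<omega>) i \<partial>M)"
    unfolding set_lebesgue_integral_def g_def mean_grad_def
    by (intro Bochner_Integration.integral_cong refl) (simp add: A_ind)
  finally show ?thesis .
qed

lemma sigma_finite_cond_algebra:
  "m \<le> depth net \<Longrightarrow> sigma_finite_subalgebra M (cond_algebra m)"
  by (intro finite_measure_subalgebra_is_sigma_finite finite_measure_subalgebra.intro
      finite_measure_subalgebra_axioms.intro subalgebra_cond_algebra) unfold_locales

lemma mixed_grad_cond_exp:
  assumes "l \<le> m" "m \<in> {1..depth net}" "i \<in> pidx net l"
  shows "AE \<omega> in M. real_cond_exp M (cond_algebra m) (\<lambda>\<omega>. mixed_grad l m (B \<omega>) (noise \<omega>) i) \<omega> =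
    mean_grad l m (B \<omega>) (noise \<omega>) i"
proof -
  interpret sigma_finite_subalgebra M "cond_algebra m"
    using assms by (intro sigma_finite_cond_algebra) auto
  show ?thesis
    using assms by (intro real_cond_exp_charact mixed_grad_cond_integral integrable_mixed_grad
        integrable_mean_grad measurable_mean_grad_cond_algebra) auto
qed

lemma expectation_mixed_grad:
  assumes "l \<le> m" "m \<in> {1..depth net}" "i \<in> pidx net l"
  shows "expectation (\<lambda>\<omega>. mixed_grad l m (B \<omega>) (noise \<omega>) i) =
    expectation (\<lambda>\<omega>. mean_grad l m (B \<omega>) (noise \<omega>) i)"
  using mixed_grad_cond_integral[OF assms, of "space M"] sets.top[of "cond_algebra m"]
    integrable_mixed_grad[OF assms] integrable_mean_grad[OF assms]
  by (simp add: set_integral_space)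

text \<open>The conditional second moment integrates to the plain one by the tower property, and the
  conditional mean agrees almost everywhere with \<open>mean_grad\<close>.\<close>

lemma integral_cond_var_mixed_grad:
  assumes lm: "l \<le> m" and m: "m \<in> {1..depth net}"
  shows "(\<integral>\<omega>. vec_cond_var M (cond_algebra m) (pidx net l)
      (\<lambda>\<omega>. mixed_grad l m (B \<omega>) (noise \<omega>)) \<omega> \<partial>M) =
    (\<integral>\<omega>. (L2_set (mixed_grad l m (B \<omega>) (noise \<omega>)) (pidx net l))\<^sup>2 \<partial>M) -
    (\<integral>\<omega>. (L2_set (mean_grad l m (B \<omega>) (noise \<omega>)) (pidx net l))\<^sup>2 \<partial>M)"
proof -
  interpret F: sigma_finite_subalgebra M "cond_algebra m"
    using m by (intro sigma_finite_cond_algebra) auto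
  let ?X = "\<lambda>\<omega>. mixed_grad l m (B \<omega>) (noise \<omega>)" and ?A = "\<lambda>\<omega>. mean_grad l m (B \<omega>) (noise \<omega>)"
  let ?E = "real_cond_exp M (cond_algebra m)"
  have X: "integrable M (\<lambda>\<omega>. (L2_set (?X \<omega>) (pidx net l))\<^sup>2)"
    and A: "integrable M (\<lambda>\<omega>. (L2_set (?A \<omega>) (pidx net l))\<^sup>2)"
    unfolding L2_set_power2
    using square_integrable_mixed_grad[OF assms] square_integrable_mean_grad[OF assms]
    by (auto intro!: Bochner_Integration.integrable_sum)
  \<comment> \<open>Finitely many coordinates, hence one common null set for all the almost sure
    equalities.\<close>
  have "AE \<omega> in M. \<forall>i\<in>pidx net l. ?E (\<lambda>\<omega>. ?X \<omega> i) \<omega> = ?A \<omega> i"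
    using mixed_grad_cond_exp[OF assms] by (intro AE_finite_allI) auto
  then have "AE \<omega> in M. vec_cond_var M (cond_algebra m) (pidx net l) ?X \<omega> =
      ?E (\<lambda>\<omega>. (L2_set (?X \<omega>) (pidx net l))\<^sup>2) \<omega> - (L2_set (?A \<omega>) (pidx net l))\<^sup>2"
    by eventually_elim (simp add: vec_cond_var_def cong: L2_set_cong)
  then have "(\<integral>\<omega>. vec_cond_var M (cond_algebra m) (pidx net l) ?X \<omega> \<partial>M) =
      (\<integral>\<omega>. ?E (\<lambda>\<omega>. (L2_set (?X \<omega>) (pidx net l))\<^sup>2) \<omega> - (L2_set (?A \<omega>) (pidx net l))\<^sup>2 \<partial>M)"
    using borel_measurable_integrable[OF A] borel_measurable_integrable[OF F.real_cond_exp_int(1)[OF X]]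
    by (intro integral_cong_AE) (auto simp: vec_cond_var_def[abs_def] L2_set_power2
        intro!: borel_measurable_diff borel_measurable_sum borel_measurable_power borel_measurable_cond_exp2)
  also have "\<dots> = (\<integral>\<omega>. (L2_set (?X \<omega>) (pidx net l))\<^sup>2 \<partial>M) - (\<integral>\<omega>. (L2_set (?A \<omega>) (pidx net l))\<^sup>2 \<partial>M)"
    using F.real_cond_exp_int[OF X] A by (subst Bochner_Integration.integral_diff) auto
  finally show ?thesis .
qed

section \<open>Telescoping over the layers\<close>

lemma mixed_grad_eq_mean_grad:
  assumes "l < m" "m \<le> depth net"
  shows "mixed_grad l m b z = mean_grad l (m - 1) b z"
proof -
  have "G_H net m (hat_H m b z) (hat_ctx net \<theta> Q b z m) = hat_H (m - 1) b z"
    using assms hat_grad_H_less[of "m - 1" net \<theta> b "hat_ctx net \<theta> Q b z"] by (simp add: hat_H_def)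
  then show ?thesis
    unfolding mixed_grad_def mean_grad_def by (subst G_Theta_between_less[OF assms(1)]) simp
qed

text \<open>The backward pass starts from the exact output gradient, so at the top no quantized
  context is read and the value does not depend on \<open>z\<close>.\<close>

lemma mean_grad_depth:
  assumes "l \<le> depth net"
  shows "mean_grad l (depth net) b z = hat_grad_Theta net \<theta> b (ctx_of net \<theta> b) l"
  using G_Theta_between_grad[OF assms order_refl, of "ctx_of net \<theta> b" \<theta> b]
  by (simp add: mean_grad_def hat_H_def hat_grad_H_depth)

text \<open>Alternates unbiasedness at one layer with the identity between consecutive layers. With
  equal means, the squared norms of the means in the two variances coincide.\<close>

lemma expectation_mixed_grad_same:
  assumes "l \<le> m" "m \<le> depth net" "1 \<le> l" "i \<in> pidx net l"
  shows "expectation (\<lambda>\<omega>. mixed_grad l l (B \<omega>) (noise \<omega>) i) =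
    expectation (\<lambda>\<omega>. mean_grad l m (B \<omega>) (noise \<omega>) i)"
  using assms
proof (induction m rule: dec_induct)
  case base
  then show ?case
    by (intro expectation_mixed_grad) auto
next
  case (step m)
  then show ?case
    using expectation_mixed_grad[of l "Suc m" i] mixed_grad_eq_mean_grad[of l "Suc m"] by simp
qed

text \<open>In the induction step the new positive term, the second moment of
  \<open>mixed_grad l (Suc m)\<close>, is that of \<open>mean_grad l m\<close> and cancels the old
  negative one.\<close>

lemma sum_integral_cond_var:
  assumes "l \<le> m" "m \<le> depth net" "1 \<le> l"
  shows "(\<Sum>j=l..m. \<integral>\<omega>. vec_cond_var M (cond_algebra j) (pidx net l)
      (\<lambda>\<omega>. mixed_grad l j (B \<omega>) (noise \<omega>)) \<omega> \<partial>M) =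
    (\<integral>\<omega>. (L2_set (mixed_grad l l (B \<omega>) (noise \<omega>)) (pidx net l))\<^sup>2 \<partial>M) -
    (\<integral>\<omega>. (L2_set (mean_grad l m (B \<omega>) (noise \<omega>)) (pidx net l))\<^sup>2 \<partial>M)"
  using assms
proof (induction m rule: dec_induct)
  case base
  then show ?case
    by (simp add: integral_cond_var_mixed_grad)
next
  case (step m)
  then show ?case
    by (simp add: integral_cond_var_mixed_grad mixed_grad_eq_mean_grad)
qed

lemma vec_var_mixed_grad:
  assumes l: "l \<in> {1..depth net}"
  shows "vec_var M (pidx net l) (\<lambda>\<omega>. mixed_grad l l (B \<omega>) (noise \<omega>)) =
    vec_var M (pidx net l) (\<lambda>\<omega>. mean_grad l (depth net) (B \<omega>) (noise \<omega>)) +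
    (\<Sum>m=l..depth net. \<integral>\<omega>. vec_cond_var M (cond_algebra m) (pidx net l)
      (\<lambda>\<omega>. mixed_grad l m (B \<omega>) (noise \<omega>)) \<omega> \<partial>M)"
proof -
  have "L2_set (\<lambda>i. expectation (\<lambda>\<omega>. mixed_grad l l (B \<omega>) (noise \<omega>) i)) (pidx net l) =
      L2_set (\<lambda>i. expectation (\<lambda>\<omega>. mean_grad l (depth net) (B \<omega>) (noise \<omega>) i)) (pidx net l)"
    using l by (intro L2_set_cong expectation_mixed_grad_same) auto
  moreover have "(\<Sum>m=l..depth net. \<integral>\<omega>. vec_cond_var M (cond_algebra m) (pidx net l)
      (\<lambda>\<omega>. mixed_grad l m (B \<omega>) (noise \<omega>)) \<omega> \<partial>M) =
    (\<integral>\<omega>. (L2_set (mixed_grad l l (B \<omega>) (noise \<omega>)) (pidx net l))\<^sup>2 \<partial>M) -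
    (\<integral>\<omega>. (L2_set (mean_grad l (depth net) (B \<omega>) (noise \<omega>)) (pidx net l))\<^sup>2 \<partial>M)"
    using l by (intro sum_integral_cond_var) auto
  ultimately show ?thesis
    unfolding vec_var_def by simp
qed

end

theorem theorem3:
  fixes M :: "'a measure"
    and net :: "'y network"
    and \<theta> :: "nat \<Rightarrow> pvec"
    and D :: "((nat \<Rightarrow> real) \<times> 'y) set"
    and dataset_loss :: "(nat \<Rightarrow> pvec) \<Rightarrow> real"
    and B :: "'a \<Rightarrow> 'y minibatch"
    and S :: "nat \<Rightarrow> 'z measure"
    and \<xi> :: "nat \<Rightarrow> 'a \<Rightarrow> 'z"
    and Q :: "nat \<Rightarrow> 'z \<Rightarrow> ctx \<Rightarrow> ctx"
  defines "L \<equiv> depth net"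
  defines "C \<equiv> \<lambda>\<omega>. ctx_of net \<theta> (B \<omega>)"
    and "Chat \<equiv> \<lambda>\<omega>. hat_ctx net \<theta> Q (B \<omega>) (\<lambda>l. \<xi> l \<omega>)"
  defines "Hhat \<equiv> \<lambda>m \<omega>. hat_grad_H net \<theta> (B \<omega>) (Chat \<omega>) m"
  assumes "prob_space M"
    and "finite D"
    and B: "B \<in> M \<rightarrow>\<^sub>M count_space (minibatches net D)"
    and \<theta>: "\<And>l. l \<in> {1..L} \<Longrightarrow> \<theta> l \<in> pidx net l \<rightarrow>\<^sub>E UNIV"
    and layer_differentiable_H:
      "\<And>l kp b. l \<in> {1..L} \<Longrightarrow> kp \<in> fidx net l \<Longrightarrow> b \<in> minibatches net D \<Longrightarrow>
        vec_differentiable (fidx net (l - 1)) (\<lambda>H. layer net l H (\<theta> l) kp)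
          (feature net \<theta> b (l - 1))"
    and layer_differentiable_Theta:
      "\<And>l kp b. l \<in> {1..L} \<Longrightarrow> kp \<in> fidx net l \<Longrightarrow> b \<in> minibatches net D \<Longrightarrow>
        vec_differentiable (pidx net l) (\<lambda>u. layer net l (feature net \<theta> b (l - 1)) u kp) (\<theta> l)"
    and loss_differentiable:
      "\<And>b. b \<in> minibatches net D \<Longrightarrow>
        vec_differentiable (fidx net L) (\<lambda>H. loss net H (labels b)) (feature net \<theta> b L)"
    and unbiased_sampling:
      "\<And>l i. l \<in> {1..L} \<Longrightarrow> i \<in> pidx net l \<Longrightarrow>
        ((\<lambda>t. dataset_loss (\<theta>(l := (\<theta> l)(i := t)))) has_real_derivative
          (\<integral>\<omega>. grad_Theta net \<theta> (B \<omega>) l i \<partial>M)) (at (\<theta> l i))"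
    and noise_indep: "prob_space.indep_vars M S \<xi> {1..L}"
    and noise_indep_batch:
      "prob_space.indep_set M
        (sets (vimage_algebra (space M) B (count_space (minibatches net D))))
        (sets (vimage_algebra (space M) (\<lambda>\<omega>. \<lambda>l\<in>{1..L}. \<xi> l \<omega>) (\<Pi>\<^sub>M l\<in>{1..L}. S l)))"
    and quantizer:
      "\<And>l. l \<in> {1..L} \<Longrightarrow> unbiased_quantizer (distr M (S l) (\<xi> l)) (cidx net l) (Q l)"
  shows "\<forall>l\<in>{1..L}.
    vec_var M (pidx net l) (\<lambda>\<omega>. hat_grad_Theta net \<theta> (B \<omega>) (Chat \<omega>) l) =
    vec_var M (pidx net l) (\<lambda>\<omega>. grad_Theta net \<theta> (B \<omega>) l) +
    (\<Sum>m=l..L. \<integral>\<omega>. vec_cond_var M (batch_grad_algebra M net D B m (Hhat m)) (pidx net l)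
        (\<lambda>\<omega>'. G_Theta_between net (C \<omega>') l m (Hhat m \<omega>') (Chat \<omega>' m)) \<omega> \<partial>M)"
proof -
  interpret prob_space M by fact
  interpret compressed_backprop M net \<theta> D B S \<xi> Q
    using assms(6) B noise_indep noise_indep_batch quantizer
    unfolding L_def by unfold_locales
  \<comment> \<open>\<open>noise\<close> is \<open>undefined\<close> outside the layers of the
    network, whereas the statement uses all of \<open>\<xi>\<close>; the two agree on every layer
    that the backward pass reads.\<close>
  have hat_ctx: "hat_ctx net \<theta> Q b (noise \<omega>) l = hat_ctx net \<theta> Q b (\<lambda>l. \<xi> l \<omega>) l"
    if "l \<in> {1..depth net}" for b \<omega> l
    using that by (simp add: hat_ctx_def noise_def)
  have Hhat: "Hhat m = (\<lambda>\<omega>. hat_H m (B \<omega>) (noise \<omega>))" if "m \<le> depth net" for m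
    unfolding Hhat_def Chat_def hat_H_def using that hat_ctx by (intro ext hat_grad_H_cong) auto
  show ?thesis
  proof
    fix l assume l: "l \<in> {1..L}"
    have hat: "hat_grad_Theta net \<theta> (B \<omega>) (Chat \<omega>) l = mixed_grad l l (B \<omega>) (noise \<omega>)" for \<omega>
      using l hat_ctx[of l] Hhat[of l, THEN fun_cong, of \<omega>]
      by (simp add: L_def mixed_grad_def G_Theta_between_same hat_grad_Theta_def Hhat_def Chat_def)
    \<comment> \<open>Differentiability is assumed at minibatches from \<open>D\<close>, so the
      identity holds on \<open>space M\<close>, which suffices under the integrals of
      \<open>vec_var\<close>.\<close>
    have grad: "grad_Theta net \<theta> (B \<omega>) l = mean_grad l (depth net) (B \<omega>) (noise \<omega>)"
      if "\<omega> \<in> space M" for \<omega>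
    proof -
      have b: "B \<omega> \<in> minibatches net D"
        using measurable_space[OF B that] by simp
      have "hat_grad_Theta net \<theta> (B \<omega>) (ctx_of net \<theta> (B \<omega>)) l = grad_Theta net \<theta> (B \<omega>) l"
        using \<theta> layer_differentiable_H[OF _ _ b] layer_differentiable_Theta[OF _ _ b]
          loss_differentiable[OF b] l unfolding L_def by (rule hat_grad_Theta_ctx_of)
      then show ?thesis
        using l mean_grad_depth[of l "B \<omega>" "noise \<omega>"] by (simp add: L_def)
    qed
    have "vec_var M (pidx net l) (\<lambda>\<omega>. grad_Theta net \<theta> (B \<omega>) l) =
        vec_var M (pidx net l) (\<lambda>\<omega>. mean_grad l (depth net) (B \<omega>) (noise \<omega>))"
      unfolding vec_var_def using grad
      by (simp cong: Bochner_Integration.integral_cong)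
    moreover have "(\<integral>\<omega>. vec_cond_var M (batch_grad_algebra M net D B m (Hhat m)) (pidx net l)
        (\<lambda>\<omega>'. G_Theta_between net (C \<omega>') l m (Hhat m \<omega>') (Chat \<omega>' m)) \<omega> \<partial>M) =
      (\<integral>\<omega>. vec_cond_var M (cond_algebra m) (pidx net l)
        (\<lambda>\<omega>. mixed_grad l m (B \<omega>) (noise \<omega>)) \<omega> \<partial>M)" if "m \<in> {l..L}" for m
      using that l hat_ctx[of m]
      by (simp add: L_def Hhat cond_algebra_def mixed_grad_def C_def Chat_def)
    ultimately show "vec_var M (pidx net l) (\<lambda>\<omega>. hat_grad_Theta net \<theta> (B \<omega>) (Chat \<omega>) l) =
      vec_var M (pidx net l) (\<lambda>\<omega>. grad_Theta net \<theta> (B \<omega>) l) +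
      (\<Sum>m=l..L. \<integral>\<omega>. vec_cond_var M (batch_grad_algebra M net D B m (Hhat m)) (pidx net l)
        (\<lambda>\<omega>'. G_Theta_between net (C \<omega>') l m (Hhat m \<omega>') (Chat \<omega>' m)) \<omega> \<partial>M)"
      using vec_var_mixed_grad[of l] l hat by (simp add: L_def)
  qed
qed

end
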